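(* Let $G$ be a three-dimensional simply-connected solvable Lie group with Lie algebra $\mathfrak{g}$, and let $\langle\cdot,\cdot\rangle$ be a left-invariant Riemannian metric on $G$ (equivalently, an inner product on $\mathfrak{g}$). Then $\langle\cdot,\cdot\rangle$ is a solvsoliton if and only if the corresponding submanifold $[\langle\cdot,\cdot\rangle]$ is a minimal submanifold of $\mathcal{M}(\mathfrak{g})\cong \mathrm{GL}_3(\mathbb{R})/\mathrm{O}(3)$ with respect to the natural $\mathrm{GL}_3(\mathbb{R})$-invariant Riemannian metric.
   Context: Identify $\mathfrak{g}$ with $\mathbb{R}^n$ ($n=\dim\mathfrak g$) as a vector space. Let $\mathcal{M}(\mathfrak{g})$ be the set of all inner products on $\mathfrak{g}$ (= left-invariant Riemannian metrics on $G$). $\mathrm{GL}_n(\mathbb{R})$ acts transitively on it by $g.\langle\cdot,\cdot\rangle:=\langle g^{-1}\cdot,g^{-1}\cdot\rangle$, giving $\mathcal{M}(\mathfrak g)=\mathrm{GL}_n(\mathbb{R})/\mathrm{O}(n)$ (base point: the inner product $\langle\cdot,\cdot\rangle_0$ making the canonical basis orthonormal). Using the reductive decomposition $\mathfrak{gl}_n(\mathbb{R})=\mathfrak{o}(n)\oplus\mathrm{sym}(n)$, with $\mathrm{sym}(n)$ the symmetric matrices, the natural Riemannian metric is the $\mathrm{GL}_n(\mathbb{R})$-invariant metric corresponding to the inner product $\langle X,Y\rangle=\mathrm{tr}(XY)$ on $\mathrm{sym}(n)$. Two inner products $\langle\cdot,\cdot\rangle_1,\langle\cdot,\cdot\rangle_2$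 are isometric up to scaling if there exist $k>0$ and a Lie algebra automorphism $f$ of $\mathfrak g$ with $\langle\cdot,\cdot\rangle_1=k\langle f\cdot,f\cdot\rangle_2$; the corresponding submanifold $[\langle\cdot,\cdot\rangle]$ is the equivalence class of $\langle\cdot,\cdot\rangle$ under this relation. (It is known that $[\langle\cdot,\cdot\rangle]$ equals the orbit $(\mathbb{R}^\times\mathrm{Aut}(\mathfrak g)).\langle\cdot,\cdot\rangle$, where $\mathbb{R}^\times\mathrm{Aut}(\mathfrak g)=\{c\varphi: c\in\mathbb{R}\setminus\{0\},\ \varphi\in\mathrm{Aut}(\mathfrak g)\}\subset\mathrm{GL}_n(\mathbb R)$.) An inner product on a solvable Lie algebra $\mathfrak g$ is a solvsoliton if its Ricci operator satisfies $\mathrm{Ric}=cI+D$ for some $c\in\mathbb{R}$ and some derivation $D\in\mathrm{Der}(\mathfrak g)$. A submanifold is minimal if its mean curvature vector vanishes. *)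

theory Defs
  imports "HOL-Analysis.Analysis"
begin

type_synonym vec3 = "real^3"
type_synonym mat3 = "real^3^3"

definition lie_algebra :: "(vec3 \<Rightarrow> vec3 \<Rightarrow> vec3) \<Rightarrow> bool" where
  "lie_algebra br \<longleftrightarrow> bilinear br \<and> (\<forall>x. br x x = 0) \<and>
     (\<forall>x y z. br x (br y z) + br y (br z x) + br z (br x y) = 0)"

fun derived_series :: "(vec3 \<Rightarrow> vec3 \<Rightarrow> vec3) \<Rightarrow> nat \<Rightarrow> vec3 set" where
  "derived_series br 0 = UNIV"
| "derived_series br (Suc k) =
     span {br x y | x y. x \<in> derived_series br k \<and> y \<in> derived_series br k}"

definition solvable_lie :: "(vec3 \<Rightarrow> vec3 \<Rightarrow> vec3) \<Rightarrow> bool" where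
  "solvable_lie br \<longleftrightarrow> (\<exists>k. derived_series br k = {0})"

definition is_derivation :: "(vec3 \<Rightarrow> vec3 \<Rightarrow> vec3) \<Rightarrow> mat3 \<Rightarrow> bool" where
  "is_derivation br D \<longleftrightarrow> (\<forall>x y. D *v br x y = br (D *v x) y + br x (D *v y))"

definition lie_aut :: "(vec3 \<Rightarrow> vec3 \<Rightarrow> vec3) \<Rightarrow> mat3 set" where
  "lie_aut br = {f. invertible f \<and> (\<forall>x y. f *v br x y = br (f *v x) (f *v y))}"

definition Sym :: "mat3 set" where
  "Sym = {A. transpose A = A}"

definition PosDef :: "mat3 set" where
  "PosDef = {P \<in> Sym. \<forall>x. x \<noteq> 0 \<longrightarrow> x \<bullet> (P *v x) > 0}"

definition ip :: "mat3 \<Rightarrow> vec3 \<Rightarrow> vec3 \<Rightarrow> real" where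
  "ip P x y = x \<bullet> (P *v y)"

text \<open>Levi-Civita connection on left-invariant fields (Koszul formula).\<close>
definition lc_nabla :: "(vec3 \<Rightarrow> vec3 \<Rightarrow> vec3) \<Rightarrow> mat3 \<Rightarrow> vec3 \<Rightarrow> vec3 \<Rightarrow> vec3" where
  "lc_nabla br P x y = (THE v. \<forall>z. ip P v z =
      (ip P (br x y) z - ip P (br y z) x + ip P (br z x) y) / 2)"

definition curv :: "(vec3 \<Rightarrow> vec3 \<Rightarrow> vec3) \<Rightarrow> mat3 \<Rightarrow> vec3 \<Rightarrow> vec3 \<Rightarrow> vec3 \<Rightarrow> vec3" where
  "curv br P x y z = lc_nabla br P x (lc_nabla br P y z) - lc_nabla br P y (lc_nabla br P x z)
                     - lc_nabla br P (br x y) z"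

definition ric_tensor :: "(vec3 \<Rightarrow> vec3 \<Rightarrow> vec3) \<Rightarrow> mat3 \<Rightarrow> vec3 \<Rightarrow> vec3 \<Rightarrow> real" where
  "ric_tensor br P y z = (\<Sum>i\<in>UNIV. (curv br P (axis i 1) y z) $ i)"

definition ricci_op :: "(vec3 \<Rightarrow> vec3 \<Rightarrow> vec3) \<Rightarrow> mat3 \<Rightarrow> vec3 \<Rightarrow> vec3" where
  "ricci_op br P x = (THE v. \<forall>w. ip P v w = ric_tensor br P x w)"

definition solvsoliton :: "(vec3 \<Rightarrow> vec3 \<Rightarrow> vec3) \<Rightarrow> mat3 \<Rightarrow> bool" where
  "solvsoliton br P \<longleftrightarrow>
     (\<exists>c::real. \<exists>D. is_derivation br D \<and> (\<forall>x. ricci_op br P x = c *\<^sub>R x + D *v x))"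

definition metric_class :: "(vec3 \<Rightarrow> vec3 \<Rightarrow> vec3) \<Rightarrow> mat3 \<Rightarrow> mat3 set" where
  "metric_class br P = {Q \<in> PosDef. \<exists>k>0. \<exists>f\<in>lie_aut br.
       \<forall>x y. ip Q x y = k * ip P (f *v x) (f *v y)}"

text \<open>GL-action g.P = g^{-T} P g^{-1}; at the base point I the tangent vector of
  t |-> exp(tX).I is -2X, so tr(XY) on sym(3) gives g_I(V,W) = tr(VW)/4, and by
  invariance g_P(V,W) = tr(P^{-1} V P^{-1} W)/4.\<close>
definition gM :: "mat3 \<Rightarrow> mat3 \<Rightarrow> mat3 \<Rightarrow> real" where
  "gM P V W = trace (matrix_inv P ** V ** matrix_inv P ** W) / 4"

definition dgM :: "mat3 \<Rightarrow> mat3 \<Rightarrow> mat3 \<Rightarrow> mat3 \<Rightarrow> real" where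
  "dgM P X Y Z = deriv (\<lambda>t. gM (P + t *\<^sub>R X) Y Z) 0"

text \<open>Christoffel map of the Levi-Civita connection (Koszul formula for constant fields).\<close>
definition christoffel :: "mat3 \<Rightarrow> mat3 \<Rightarrow> mat3 \<Rightarrow> mat3" where
  "christoffel P X Y = (THE G. G \<in> Sym \<and> (\<forall>Z\<in>Sym.
      gM P G Z = (dgM P X Y Z + dgM P Y X Z - dgM P Z X Y) / 2))"

definition curve2 :: "mat3 set \<Rightarrow> mat3 \<Rightarrow> mat3 \<Rightarrow> mat3 \<Rightarrow> bool" where
  "curve2 S P v a \<longleftrightarrow> (\<exists>\<gamma> \<gamma>'. (\<forall>t. \<gamma> t \<in> S) \<and> \<gamma> 0 = P \<and>
      (\<forall>t. (\<gamma> has_vector_derivative \<gamma>' t) (at t)) \<and> \<gamma>' 0 = v \<and>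
      (\<gamma>' has_vector_derivative a) (at 0))"

definition tspace :: "mat3 set \<Rightarrow> mat3 \<Rightarrow> mat3 set" where
  "tspace S P = {v. \<exists>a. curve2 S P v a}"

definition normal_part :: "mat3 set \<Rightarrow> mat3 \<Rightarrow> mat3 \<Rightarrow> mat3" where
  "normal_part S P w = (THE n. n \<in> Sym \<and> (\<forall>u\<in>tspace S P. gM P n u = 0) \<and> w - n \<in> tspace S P)"

text \<open>S is minimal: at every point the mean curvature vector
  sum_i II(e_i,e_i), II(v,v) = (gamma''(0) + Gamma(v,v))^perp, vanishes,
  for a gM-orthonormal basis e_i of the tangent space.\<close>
definition minimal_submanifold :: "mat3 set \<Rightarrow> bool" where
  "minimal_submanifold S \<longleftrightarrow> S \<subseteq> PosDef \<and> (\<forall>P\<in>S. \<exists>es as.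
      length as = length es \<and>
      (\<forall>i<length es. \<forall>j<length es. gM P (es!i) (es!j) = (if i = j then 1 else 0)) \<and>
      span (set es) = tspace S P \<and>
      (\<forall>i<length es. curve2 S P (es!i) (as!i)) \<and>
      normal_part S P (\<Sum>i<length es. as!i + christoffel P (es!i) (es!i)) = 0)"

end

theory Submission
  imports Defs
begin

text \<open>An alternating bracket on \<open>\<real>\<^sup>3\<close> has the form \<open>M (x \<times> y)\<close>, and solvability together with the
  Jacobi identity yields an abelian ideal of dimension two. Hence, in a suitable orthonormal basis,
  the algebra is \<open>\<real>\<close> acting on \<open>\<real>\<^sup>2\<close> by a matrix \<open>A\<close>, and a rotation makes the diagonal of \<open>A\<close> constant:
  \<open>A = ((t, a), (b, t))\<close>. Both sides of the equivalence then say that \<open>A\<close> is normal (\<open>a\<^sup>2 = b\<^sup>2\<close>)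
  or nilpotent (\<open>t = 0\<close>, \<open>a b = 0\<close>).

  For the solvsoliton condition this is read off the Ricci operator. For minimality, the group
  \<open>\<real>\<^sup>\<times>Aut\<close> acts by isometries, so one point suffices. If \<open>A\<close> is scalar or nilpotent, the class is
  everything. Otherwise \<open>(b Q\<^sub>3\<^sub>3 - a Q\<^sub>2\<^sub>2)\<^sup>2 = (b - a)\<^sup>2 (Q\<^sub>2\<^sub>2 Q\<^sub>3\<^sub>3 - Q\<^sub>2\<^sub>3\<^sup>2)\<close> on the class: up to homogeneous
  directions the class is an orbit in the hyperbolic plane of the one-parameter group generated by the
  traceless part of \<open>A\<close>, and among these orbits exactly the geodesics and the fixed points are minimal.\<close>

section \<open>Pullback of inner products\<close>

text \<open>The Gram matrix of the inner product \<open>Q\<close> evaluated on \<open>g x\<close>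
  and \<open>g y\<close>, that is, the action of the inverse of \<open>g\<close> on
  \<open>Q\<close>. Hence composition reverses the order.\<close>

definition pull :: "mat3 \<Rightarrow> mat3 \<Rightarrow> mat3" where
  "pull g Q = transpose g ** Q ** g"

text \<open>Chosen so that \<open>g\<close> is a Lie algebra isomorphism from
  \<open>transport g br\<close> to \<open>br\<close>; together with \<open>pull g P\<close> it
  becomes an isometry of metric Lie algebras.\<close>

definition transport :: "mat3 \<Rightarrow> (vec3 \<Rightarrow> vec3 \<Rightarrow> vec3) \<Rightarrow> vec3 \<Rightarrow> vec3 \<Rightarrow> vec3" where
  "transport g br x y = matrix_inv g *v br (g *v x) (g *v y)"

lemma matrix_inv_cancel:
  fixes g :: "real^'n^'n"
  assumes "invertible g"
  shows "g ** matrix_inv g = mat 1" "matrix_inv g ** g = mat 1"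
    "A ** g ** matrix_inv g = A" "A ** matrix_inv g ** g = A"
    "g *v (matrix_inv g *v x) = x" "matrix_inv g *v (g *v x) = x"
proof -
  show 1: "g ** matrix_inv g = mat 1" "matrix_inv g ** g = mat 1"
    using someI_ex[OF assms[unfolded invertible_def]] by (simp_all add: matrix_inv_def)
  show "A ** g ** matrix_inv g = A" "A ** matrix_inv g ** g = A"
    by (simp_all add: matrix_mul_assoc[symmetric] 1)
  show "g *v (matrix_inv g *v x) = x" "matrix_inv g *v (g *v x) = x"
    by (simp_all add: matrix_vector_mul_assoc 1)
qed

lemma matrix_inv_unique_left:
  fixes g :: "real^'n^'n"
  assumes "h ** g = mat 1"
  shows "matrix_inv g = h" "invertible g"
proof -
  show inv: "invertible g"
    using assms invertible_left_inverse by blast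
  have "h ** g ** matrix_inv g = matrix_inv g" using assms by simp
  then show "matrix_inv g = h" by (simp add: matrix_inv_cancel[OF inv])
qed

lemma matrix_inv_mult:
  fixes g h :: "real^'n^'n"
  assumes "invertible g" "invertible h"
  shows "matrix_inv (g ** h) = matrix_inv h ** matrix_inv g"
proof (rule matrix_inv_unique_left)
  have "matrix_inv h ** matrix_inv g ** (g ** h) = matrix_inv h ** (matrix_inv g ** g) ** h"
    by (simp add: matrix_mul_assoc)
  then show "matrix_inv h ** matrix_inv g ** (g ** h) = mat 1"
    by (simp add: matrix_inv_cancel assms)
qed

lemma matrix_inv_matrix_inv:
  fixes g :: "real^'n^'n"
  assumes "invertible g"
  shows "matrix_inv (matrix_inv g) = g" "invertible (matrix_inv g)"
  using matrix_inv_unique_left[OF matrix_inv_cancel(1)[OF assms]] by auto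

lemma matrix_inv_transpose:
  fixes g :: "real^'n^'n"
  assumes "invertible g"
  shows "matrix_inv (transpose g) = transpose (matrix_inv g)" "invertible (transpose g)"
proof -
  have "transpose (matrix_inv g) ** transpose g = mat 1"
    by (simp add: matrix_transpose_mul[symmetric] matrix_inv_cancel assms)
  then show "matrix_inv (transpose g) = transpose (matrix_inv g)" "invertible (transpose g)"
    using matrix_inv_unique_left by blast+
qed

lemma matrix_inv_mat_1: "matrix_inv (mat 1 :: real^'n^'n) = mat 1" "invertible (mat 1 :: real^'n^'n)"
  using matrix_inv_unique_left[of "mat 1" "mat 1 :: real^'n^'n"] by auto

lemma matrix_add_rdistrib: "(A + B) ** C = A ** C + B ** (C :: 'a::semiring_1^'p^'n)"
  by (simp add: matrix_matrix_mult_def vec_eq_iff distrib_right sum.distrib)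

lemma pull_mult: "pull h (pull g Q) = pull (g ** h) Q"
  by (simp add: pull_def matrix_transpose_mul matrix_mul_assoc)

lemma pull_1 [simp]: "pull (mat 1) Q = Q"
  by (simp add: pull_def)

lemma pull_inverse:
  assumes "invertible g"
  shows "pull (matrix_inv g) (pull g Q) = Q" "pull g (pull (matrix_inv g) Q) = Q"
  by (simp_all add: pull_mult matrix_inv_cancel assms)

lemma linear_pull: "linear (pull g)"
  by (rule linearI)
    (simp_all add: pull_def matrix_add_ldistrib matrix_add_rdistrib scalar_matrix_assoc matrix_scalar_ac)

lemmas pull_linear_simps = linear_add[OF linear_pull] linear_diff[OF linear_pull]
  linear_cmul[OF linear_pull] linear_sum[OF linear_pull] linear_0[OF linear_pull]

lemma ip_pull: "ip (pull g P) x y = ip P (g *v x) (g *v y)"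
proof -
  have "x \<bullet> (transpose g *v z) = (g *v x) \<bullet> z" for z
    by (metis dot_lmul_matrix inner_commute transpose_matrix_vector)
  then show ?thesis
    by (simp add: ip_def pull_def matrix_vector_mul_assoc[symmetric] del: transpose_matrix_vector)
qed

lemma matrix_entry_ip: "P $ i $ j = ip P (axis i 1) (axis j 1)"
  by (simp add: ip_def matrix_vector_mul_component inner_axis' inner_axis)

lemma ip_ext: "(\<And>x y. ip P x y = ip Q x y) \<Longrightarrow> P = Q"
  by (simp add: vec_eq_iff matrix_entry_ip)

lemma ip_linear_simps:
  "ip P (x + y) z = ip P x z + ip P y z" "ip P x (y + z) = ip P x y + ip P x z"
  "ip P (c *\<^sub>R x) z = c * ip P x z" "ip P x (c *\<^sub>R z) = c * ip P x z"
  "ip P (x - y) z = ip P x z - ip P y z" "ip P x (y - z) = ip P x y - ip P x z"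
  by (simp_all add: ip_def inner_add_left inner_add_right inner_diff_left inner_diff_right
      matrix_vector_right_distrib matrix_vector_mult_diff_distrib matrix_vector_mult_scaleR)

lemma Sym_iff: "A \<in> Sym \<longleftrightarrow> (\<forall>i j. A $ i $ j = A $ j $ i)"
  by (auto simp: Sym_def transpose_def vec_eq_iff)

lemma ip_commute: "P \<in> Sym \<Longrightarrow> ip P x y = ip P y x"
proof -
  assume "P \<in> Sym"
  then have "transpose P = P" by (simp add: Sym_def)
  then have "P *v x = x v* P" using transpose_matrix_vector[of P x] by simp
  then have "ip P y x = y \<bullet> (x v* P)" by (simp add: ip_def)
  also have "\<dots> = (x v* P) \<bullet> y" by (rule inner_commute)
  finally show ?thesis by (simp add: ip_def dot_lmul_matrix)
qed

lemma subspace_Sym: "subspace Sym"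
  by (auto simp: subspace_def Sym_iff)

lemma pull_Sym: "Q \<in> Sym \<Longrightarrow> pull g Q \<in> Sym"
  by (simp add: Sym_def pull_def matrix_transpose_mul matrix_mul_assoc)

lemma PosDef_Sym: "P \<in> PosDef \<Longrightarrow> P \<in> Sym"
  by (simp add: PosDef_def)

lemma PosDef_ip_pos: "P \<in> PosDef \<Longrightarrow> x \<noteq> 0 \<Longrightarrow> ip P x x > 0"
  by (simp add: PosDef_def ip_def)

lemma PosDefI: "P \<in> Sym \<Longrightarrow> (\<And>x. x \<noteq> 0 \<Longrightarrow> ip P x x > 0) \<Longrightarrow> P \<in> PosDef"
  by (simp add: PosDef_def ip_def)

lemma invertible_eq_0_iff:
  fixes g :: "real^'n^'n"
  assumes "invertible g" shows "g *v x = 0 \<longleftrightarrow> x = 0"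
  by (metis assms matrix_inv_cancel(6) matrix_vector_mult_0_right)

lemma pull_PosDef:
  assumes "invertible g" "P \<in> PosDef" shows "pull g P \<in> PosDef"
proof (rule PosDefI)
  show "pull g P \<in> Sym" using assms by (intro pull_Sym PosDef_Sym)
  show "ip (pull g P) x x > 0" if "x \<noteq> 0" for x
    unfolding ip_pull using that assms invertible_eq_0_iff by (intro PosDef_ip_pos) auto
qed

lemma mat_1_PosDef: "mat 1 \<in> PosDef"
  by (rule PosDefI) (auto simp: ip_def Sym_def)

lemma PosDef_invertible:
  assumes "P \<in> PosDef" shows "invertible P"
proof -
  have "x = 0" if "P *v x = 0" for x
    using that PosDef_ip_pos[OF assms, of x] by (auto simp: ip_def)
  then show ?thesis
    using invertible_left_inverse matrix_left_invertible_ker by blast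
qed

lemma PosDef_ip_eq_iff:
  assumes "P \<in> PosDef" shows "(\<forall>z. ip P v z = ip P w z) \<longleftrightarrow> v = w"
proof
  assume "\<forall>z. ip P v z = ip P w z"
  then have "ip P (v - w) (v - w) = 0" by (simp add: ip_linear_simps)
  then show "v = w" using PosDef_ip_pos[OF assms, of "v - w"] by force
qed simp

text \<open>Supplies existence for the definite descriptions in \<open>lc_nabla\<close> and
  \<open>ricci_op\<close>; uniqueness comes from \<open>PosDef_ip_eq_iff\<close>.\<close>

lemma PosDef_riesz:
  assumes "P \<in> PosDef" "linear l" shows "\<exists>v. \<forall>z. ip P v z = l z"
proof -
  define u where "u = adjoint l 1"
  have l: "l z = u \<bullet> z" for z
    unfolding u_def by (metis adjoint_works assms(2) inner_commute inner_real_def mult.commute mult_1)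
  have "ip P (matrix_inv P *v u) z = l z" for z
  proof -
    have "ip P (matrix_inv P *v u) z = ip P z (matrix_inv P *v u)"
      using assms ip_commute PosDef_Sym by blast
    then show ?thesis
      by (simp add: ip_def l matrix_inv_cancel PosDef_invertible[OF assms(1)] inner_commute)
  qed
  then show ?thesis by blast
qed

section \<open>The invariant metric and its Christoffel map\<close>

definition m33 :: "real \<Rightarrow> real \<Rightarrow> real \<Rightarrow> real \<Rightarrow> real \<Rightarrow> real \<Rightarrow> real \<Rightarrow> real \<Rightarrow> real \<Rightarrow> mat3" where
  "m33 a b c d e f g h i = vector [vector [a, b, c], vector [d, e, f], vector [g, h, i]]"

lemma m33_nth [simp]:
  "m33 a b c d e f g h i $ 1 $ 1 = a" "m33 a b c d e f g h i $ 1 $ 2 = b" "m33 a b c d e f g h i $ 1 $ 3 = c"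
  "m33 a b c d e f g h i $ 2 $ 1 = d" "m33 a b c d e f g h i $ 2 $ 2 = e" "m33 a b c d e f g h i $ 2 $ 3 = f"
  "m33 a b c d e f g h i $ 3 $ 1 = g" "m33 a b c d e f g h i $ 3 $ 2 = h" "m33 a b c d e f g h i $ 3 $ 3 = i"
  by (simp_all add: m33_def vector_3)

lemma mat3_eq_iff:
  "(A :: mat3) = B \<longleftrightarrow> A $ 1 $ 1 = B $ 1 $ 1 \<and> A $ 1 $ 2 = B $ 1 $ 2 \<and> A $ 1 $ 3 = B $ 1 $ 3 \<and>
    A $ 2 $ 1 = B $ 2 $ 1 \<and> A $ 2 $ 2 = B $ 2 $ 2 \<and> A $ 2 $ 3 = B $ 2 $ 3 \<and>
    A $ 3 $ 1 = B $ 3 $ 1 \<and> A $ 3 $ 2 = B $ 3 $ 2 \<and> A $ 3 $ 3 = B $ 3 $ 3"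
  by (auto simp: vec_eq_iff forall_3)

lemma mat3_mult_nth: "((A :: mat3) ** B) $ i $ j = A $ i $ 1 * B $ 1 $ j + A $ i $ 2 * B $ 2 $ j + A $ i $ 3 * B $ 3 $ j"
  by (simp add: matrix_matrix_mult_def sum_3)

lemma mat3_vec_nth: "((A :: mat3) *v x) $ i = A $ i $ 1 * x $ 1 + A $ i $ 2 * x $ 2 + A $ i $ 3 * x $ 3"
  by (simp add: matrix_vector_mult_def sum_3)

lemma transpose_nth: "transpose A $ i $ j = A $ j $ i"
  by (simp add: transpose_def)

lemma mat_1_nth [simp]: "(mat 1 :: mat3) $ i $ j = (if i = j then 1 else 0)"
  by (simp add: mat_def)

lemma trace_3: "trace (A :: mat3) = A $ 1 $ 1 + A $ 2 $ 2 + A $ 3 $ 3"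
  by (simp add: trace_def sum_3)

lemma inner_vec3: "(x :: vec3) \<bullet> y = x $ 1 * y $ 1 + x $ 2 * y $ 2 + x $ 3 * y $ 3"
  by (simp add: inner_vec_def sum_3)

lemmas mat3_simps = mat3_mult_nth mat3_vec_nth transpose_nth trace_3 inner_vec3

text \<open>Completing squares, starting with the third coordinate. The factor is lower triangular,
  so it preserves the span of \<open>e\<^sub>2, e\<^sub>3\<close>, the abelian ideal of the model
  algebras; this matters when the orbit is all of \<open>PosDef\<close>.\<close>

lemma PosDef_cholesky:
  assumes "Q \<in> PosDef"
  obtains a b c d e f where "a > 0" "c > 0" "f > 0"
    "Q = transpose (m33 a 0 0 b c 0 d e f) ** m33 a 0 0 b c 0 d e f"
    "invertible (m33 a 0 0 b c 0 d e f)"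
proof -
  have sym: "Q $ 2 $ 1 = Q $ 1 $ 2" "Q $ 3 $ 1 = Q $ 1 $ 3" "Q $ 3 $ 2 = Q $ 2 $ 3"
    using PosDef_Sym[OF assms] by (auto simp: Sym_iff)
  have pos: "Q $ 1 $ 1 * x\<^sup>2 + Q $ 2 $ 2 * y\<^sup>2 + Q $ 3 $ 3 * z\<^sup>2 + 2 * Q $ 1 $ 2 * x * y
      + 2 * Q $ 1 $ 3 * x * z + 2 * Q $ 2 $ 3 * y * z > 0" if "x \<noteq> 0 \<or> y \<noteq> 0 \<or> z \<noteq> 0" for x y z
  proof -
    have "(vector [x, y, z] :: vec3) \<noteq> 0"
      using that by (auto simp: vec_eq_iff forall_3 vector_3)
    from PosDef_ip_pos[OF assms this] show ?thesis
      by (simp add: ip_def mat3_simps vector_3 sym power2_eq_square algebra_simps)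
  qed
  have p3: "Q $ 3 $ 3 > 0" using pos[of 0 0 1] by simp
  define f where "f = sqrt (Q $ 3 $ 3)"
  have f: "f > 0" "Q $ 3 $ 3 = f\<^sup>2" using p3 by (simp_all add: f_def)
  define e where "e = Q $ 2 $ 3 / f"
  define d where "d = Q $ 1 $ 3 / f"
  have ed: "Q $ 2 $ 3 = e * f" "Q $ 1 $ 3 = d * f" using f by (simp_all add: e_def d_def)
  \<comment> \<open>The left side is the minimum of the form over vectors with first two coordinates
    0 and 1, attained at third coordinate \<open>- e / f\<close>.\<close>
  have "Q $ 2 $ 2 - e\<^sup>2 = Q $ 2 $ 2 * 1\<^sup>2 + Q $ 3 $ 3 * (- e / f)\<^sup>2 + 2 * Q $ 2 $ 3 * 1 * (- e / f)"
    using f by (simp add: ed power2_eq_square)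
  with pos[of 0 1 "- e / f"] have p2: "Q $ 2 $ 2 - e\<^sup>2 > 0" by simp
  define c where "c = sqrt (Q $ 2 $ 2 - e\<^sup>2)"
  have c: "c > 0" "Q $ 2 $ 2 = c\<^sup>2 + e\<^sup>2" using p2 by (simp_all add: c_def)
  define b where "b = (Q $ 1 $ 2 - d * e) / c"
  have b: "Q $ 1 $ 2 = b * c + d * e" using c by (simp add: b_def)
  \<comment> \<open>\<open>y\<close> and \<open>z\<close> make the two completed squares vanish, so
    the form at \<open>(1, y, z)\<close> equals the remaining pivot.\<close>
  define y where "y = - b / c"
  define z where "z = - (d + e * y) / f"
  have y: "c * y = - b" and z: "f * z = - (d + e * y)" using c f by (simp_all add: y_def z_def)
  have "Q $ 1 $ 1 * 1\<^sup>2 + Q $ 2 $ 2 * y\<^sup>2 + Q $ 3 $ 3 * z\<^sup>2 + 2 * Q $ 1 $ 2 * 1 * y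
      + 2 * Q $ 1 $ 3 * 1 * z + 2 * Q $ 2 $ 3 * y * z
      = (Q $ 1 $ 1 - b\<^sup>2 - d\<^sup>2) + (b + c * y)\<^sup>2 + (d + e * y + f * z)\<^sup>2"
    by (simp add: b c ed f power2_eq_square algebra_simps)
  with pos[of 1 y z] y z have p1: "Q $ 1 $ 1 - b\<^sup>2 - d\<^sup>2 > 0" by simp
  define a where "a = sqrt (Q $ 1 $ 1 - b\<^sup>2 - d\<^sup>2)"
  have a: "a > 0" "Q $ 1 $ 1 = a\<^sup>2 + b\<^sup>2 + d\<^sup>2" using p1 by (simp_all add: a_def)
  show thesis
  proof
    show "Q = transpose (m33 a 0 0 b c 0 d e f) ** m33 a 0 0 b c 0 d e f"
      by (simp add: mat3_eq_iff mat3_simps sym a b c ed f power2_eq_square algebra_simps)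
    show "invertible (m33 a 0 0 b c 0 d e f)"
      using a c f by (simp add: invertible_det_nz det_3)
  qed (use a c f in auto)
qed

lemma PosDef_eq_pull_mat_1:
  assumes "Q \<in> PosDef" obtains g where "invertible g" "Q = pull g (mat 1)"
proof -
  obtain a b c d e f where "Q = transpose (m33 a 0 0 b c 0 d e f) ** m33 a 0 0 b c 0 d e f"
    "invertible (m33 a 0 0 b c 0 d e f)"
    using PosDef_cholesky[OF assms] by metis
  then show thesis using that by (simp add: pull_def)
qed

section \<open>Differentiating the metric along lines\<close>

lemma bounded_bilinear_matrix_mult:
  "bounded_bilinear ((**) :: real^'n^'m \<Rightarrow> real^'p^'n \<Rightarrow> real^'p^'m)"
  unfolding bilinear_conv_bounded_bilinear[symmetric] bilinear_def
  by (auto intro!: linearI simp: matrix_add_ldistrib matrix_add_rdistrib scalar_matrix_assoc matrix_scalar_ac)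

lemmas matrix_mult_simps =
  bounded_bilinear.add_left[OF bounded_bilinear_matrix_mult]
  bounded_bilinear.add_right[OF bounded_bilinear_matrix_mult]
  bounded_bilinear.diff_left[OF bounded_bilinear_matrix_mult]
  bounded_bilinear.diff_right[OF bounded_bilinear_matrix_mult]
  bounded_bilinear.minus_left[OF bounded_bilinear_matrix_mult]
  bounded_bilinear.minus_right[OF bounded_bilinear_matrix_mult]
  bounded_bilinear.scaleR_left[OF bounded_bilinear_matrix_mult]
  bounded_bilinear.scaleR_right[OF bounded_bilinear_matrix_mult]

lemma linear_trace: "linear (trace :: real^'n^'n \<Rightarrow> real)"
  by (rule linearI) (simp_all add: trace_def sum.distrib sum_distrib_left)

text \<open>The resolvent identity. It yields both the continuity of inversion and an exact
  difference quotient for the metric.\<close>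

lemma matrix_inv_perturb:
  fixes P :: mat3
  assumes "invertible P" "invertible (P + t *\<^sub>R X)"
  shows "matrix_inv (P + t *\<^sub>R X) = matrix_inv P - t *\<^sub>R (matrix_inv (P + t *\<^sub>R X) ** X ** matrix_inv P)"
    (is "?N = ?R - _")
proof -
  have "?R = ?N ** (P + t *\<^sub>R X) ** ?R" by (simp add: matrix_inv_cancel assms)
  also have "\<dots> = ?N ** P ** ?R + t *\<^sub>R (?N ** X ** ?R)"
    by (simp only: matrix_mult_simps)
  finally have "?R = ?N + t *\<^sub>R (?N ** X ** ?R)" by (simp add: matrix_inv_cancel assms)
  then show ?thesis by (metis add_diff_cancel_right')
qed

lemma eventually_invertible:
  fixes P :: mat3
  assumes "invertible P"
  shows "\<forall>\<^sub>F t in at 0. invertible (P + t *\<^sub>R X)"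
proof -
  have "((\<lambda>t. det (P + t *\<^sub>R X)) \<longlongrightarrow> det (P + 0 *\<^sub>R X)) (at 0)"
    unfolding det_3 by (intro tendsto_intros)
  moreover have "det (P + 0 *\<^sub>R X) \<noteq> 0" using assms by (simp add: invertible_det_nz)
  ultimately have "\<forall>\<^sub>F t in at 0. det (P + t *\<^sub>R X) \<noteq> 0" by (rule tendsto_imp_eventually_ne)
  then show ?thesis by (simp add: invertible_det_nz)
qed

text \<open>For small \<open>t\<close> the resolvent identity bounds the norm of the perturbed
  inverse by that of \<open>matrix_inv P\<close> plus half of itself, hence by twice the former. The
  same identity then gives a difference of order \<open>t\<close>.\<close>

lemma tendsto_matrix_inv:
  fixes P :: mat3
  assumes "invertible P"
  shows "((\<lambda>t. matrix_inv (P + t *\<^sub>R X)) \<longlongrightarrow> matrix_inv P) (at 0)"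
proof -
  let ?R = "matrix_inv P" and ?N = "\<lambda>t. matrix_inv (P + t *\<^sub>R X)"
  obtain K where K: "K > 0" "\<And>A B. norm ((A :: mat3) ** (B :: mat3)) \<le> norm A * norm B * K"
    using bounded_bilinear.pos_bounded[OF bounded_bilinear_matrix_mult] by blast
  \<comment> \<open>The summand 1 keeps \<open>L\<close> positive even when \<open>X\<close> is
    zero.\<close>
  define L where "L = norm (X ** ?R) * K + 1"
  have L: "L > 0" using K by (simp add: L_def add_nonneg_pos)
  have NL: "norm (A ** X ** ?R) \<le> norm A * L" for A :: mat3
    using K(2)[of A "X ** ?R"] by (simp add: L_def matrix_mul_assoc algebra_simps) (smt (verit) norm_ge_zero)
  have ev: "\<forall>\<^sub>F t in at (0::real). \<bar>t\<bar> < 1 / (2 * L)"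
    using L by (auto simp: eventually_at intro!: exI[of _ "1 / (2 * L)"])
  have "\<forall>\<^sub>F t in at 0. norm (?N t - ?R) \<le> \<bar>t\<bar> * (2 * norm ?R * L)"
    using eventually_invertible[OF assms, of X] ev
  proof eventually_elim
    case (elim t)
    have eq: "?N t = ?R - t *\<^sub>R (?N t ** X ** ?R)"
      using matrix_inv_perturb[OF assms elim(1)] .
    have "norm (?N t) \<le> norm ?R + norm (t *\<^sub>R (?N t ** X ** ?R))"
      by (subst eq) (rule norm_triangle_ineq4)
    also have "\<dots> \<le> norm ?R + \<bar>t\<bar> * (norm (?N t) * L)"
      using NL[of "?N t"] by (simp add: mult_left_mono)
    also have "\<bar>t\<bar> * (norm (?N t) * L) \<le> (1 / (2 * L)) * (norm (?N t) * L)"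
      using elim(2) L by (intro mult_right_mono) auto
    finally have le: "norm (?N t) \<le> 2 * norm ?R" using L by simp
    have "norm (?N t - ?R) = norm (t *\<^sub>R (?N t ** X ** ?R))"
      by (subst eq) simp
    also have "\<dots> \<le> \<bar>t\<bar> * (norm (?N t) * L)"
      using NL[of "?N t"] by (simp add: mult_left_mono)
    also have "\<dots> \<le> \<bar>t\<bar> * (2 * norm ?R * L)"
      using le L by (intro mult_left_mono mult_right_mono) auto
    finally show ?case .
  qed
  moreover have "((\<lambda>t. \<bar>t\<bar> * (2 * norm ?R * L)) \<longlongrightarrow> 0) (at 0)"
    by (intro tendsto_eq_intros) auto
  ultimately have "((\<lambda>t. ?N t - ?R) \<longlongrightarrow> 0) (at 0)"
    by (rule Lim_null_comparison)
  then show ?thesis by (simp add: LIM_zero_iff)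
qed

text \<open>By the resolvent identity the difference quotient equals \<open>?q t\<close> exactly for
  small nonzero \<open>t\<close>; only continuity of the inverse is then needed for the limit. The
  two traces come from varying the two inverses in \<open>gM\<close>.\<close>

lemma dgM_eq:
  assumes "invertible P"
  defines "R \<equiv> matrix_inv P"
  shows "dgM P X Y Z = - (trace (R ** X ** R ** Y ** R ** Z) + trace (R ** Y ** R ** X ** R ** Z)) / 4"
proof -
  let ?N = "\<lambda>t. matrix_inv (P + t *\<^sub>R X)"
  let ?q = "\<lambda>t. - (trace (?N t ** X ** R ** Y ** ?N t ** Z) + trace (R ** Y ** ?N t ** X ** R ** Z)) / 4"
  have tr: "((\<lambda>t. trace (F t)) \<longlongrightarrow> trace A) (at (0::real))" if "(F \<longlongrightarrow> A) (at 0)" for F and A :: mat3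
    by (rule bounded_linear.tendsto[OF linear_trace[unfolded linear_conv_bounded_linear] that])
  note tm = bounded_bilinear.tendsto[OF bounded_bilinear_matrix_mult]
  have lim: "(?q \<longlongrightarrow> - (trace (R ** X ** R ** Y ** R ** Z) + trace (R ** Y ** R ** X ** R ** Z)) / 4) (at 0)"
    unfolding R_def by (intro tendsto_intros tr tm tendsto_matrix_inv assms) auto
  have ev: "\<forall>\<^sub>F t in at 0. ?q t = (gM (P + t *\<^sub>R X) Y Z - gM P Y Z) / t"
    using eventually_invertible[OF assms(1), of X] eventually_at_ball'[of 1 0 UNIV, simplified]
  proof eventually_elim
    case (elim t)
    define N where "N = ?N t"
    have eq: "N = R - t *\<^sub>R (N ** X ** R)"
      using matrix_inv_perturb[OF assms(1) elim(1)] by (simp add: R_def N_def)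
    have eq': "N - R = (- t) *\<^sub>R (N ** X ** R)" by (subst eq) simp
    have "N ** Y ** N ** Z - R ** Y ** R ** Z = (N - R) ** Y ** N ** Z + R ** Y ** (N - R) ** Z"
      by (simp add: matrix_mult_simps)
    also have "\<dots> = (- t) *\<^sub>R (N ** X ** R ** Y ** N ** Z + R ** Y ** N ** X ** R ** Z)"
      unfolding eq' by (simp add: matrix_mult_simps matrix_mul_assoc scaleR_add_right)
    finally have F: "N ** Y ** N ** Z - R ** Y ** R ** Z
        = (- t) *\<^sub>R (N ** X ** R ** Y ** N ** Z + R ** Y ** N ** X ** R ** Z)" .
    have "trace (N ** Y ** N ** Z) - trace (R ** Y ** R ** Z) = trace (N ** Y ** N ** Z - R ** Y ** R ** Z)"
      by (simp only: trace_sub)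
    also have "\<dots> = - t * (trace (N ** X ** R ** Y ** N ** Z) + trace (R ** Y ** N ** X ** R ** Z))"
      unfolding F by (simp only: linear_cmul[OF linear_trace] trace_add real_scaleR_def)
    finally have "trace (N ** Y ** N ** Z) - trace (R ** Y ** R ** Z)
        = - t * (trace (N ** X ** R ** Y ** N ** Z) + trace (R ** Y ** N ** X ** R ** Z))" .
    then show ?case
      using elim(2) by (simp add: gM_def N_def[symmetric] R_def[symmetric] field_simps)
  qed
  have "((\<lambda>t. gM (P + t *\<^sub>R X) Y Z) has_field_derivative
      - (trace (R ** X ** R ** Y ** R ** Z) + trace (R ** Y ** R ** X ** R ** Z)) / 4) (at 0)"
    unfolding DERIV_def using Lim_transform_eventually[OF lim ev] by simp
  then show ?thesis unfolding dgM_def by (rule DERIV_imp_deriv)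
qed

text \<open>The matrix under the trace is merely conjugated by \<open>g\<close>, so the general
  linear group acts by isometries.\<close>

lemma gM_pull:
  assumes "invertible g" "invertible P"
  shows "gM (pull g P) (pull g V) (pull g W) = gM P V W"
proof -
  let ?h = "matrix_inv g" and ?R = "matrix_inv P"
  note inv = assms matrix_inv_transpose(2)[OF assms(1)] invertible_mult
  have R: "matrix_inv (pull g P) = ?h ** ?R ** matrix_inv (transpose g)"
    unfolding pull_def by (simp add: inv matrix_inv_mult matrix_mul_assoc)
  have "matrix_inv (pull g P) ** pull g V ** matrix_inv (pull g P) ** pull g W = ?h ** (?R ** V ** ?R ** W ** g)"
    unfolding R unfolding pull_def by (simp add: matrix_mul_assoc matrix_inv_cancel inv)
  also have "trace \<dots> = trace (?R ** V ** ?R ** W)"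
    by (subst trace_mul_sym) (simp add: matrix_inv_cancel inv)
  finally show ?thesis by (simp add: gM_def)
qed

lemma gM_mat_1: "gM (mat 1) V W = trace (V ** W) / 4"
  by (simp add: gM_def matrix_inv_mat_1)

lemma gM_commute: "gM P V W = gM P W V"
  unfolding gM_def by (metis matrix_mul_assoc trace_mul_sym)

lemma linear_gM: "linear (gM P V)"
  by (rule linearI) (simp_all add: gM_def matrix_mult_simps trace_add linear_cmul[OF linear_trace] add_divide_distrib)

lemma linear_gM_left: "linear (\<lambda>V. gM P V W)"
  using linear_gM[of P W] by (simp add: gM_commute[of P _ W])

lemmas gM_simps = linear_add[OF linear_gM] linear_diff[OF linear_gM] linear_cmul[OF linear_gM]
  linear_sum[OF linear_gM] linear_0[OF linear_gM]
  linear_add[OF linear_gM_left] linear_diff[OF linear_gM_left] linear_cmul[OF linear_gM_left]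
  linear_sum[OF linear_gM_left] linear_0[OF linear_gM_left]

text \<open>After moving \<open>P\<close> to the identity, four times the squared norm of a
  symmetric matrix is the sum of the squares of its entries.\<close>

lemma gM_eq_0_imp:
  assumes "P \<in> PosDef" "V \<in> Sym" "gM P V V = 0" shows "V = 0"
proof -
  obtain g where g: "invertible g" "P = pull g (mat 1)" using PosDef_eq_pull_mat_1[OF assms(1)] .
  define W where "W = pull (matrix_inv g) V"
  have W: "V = pull g W" "W \<in> Sym" using g assms by (simp_all add: W_def pull_inverse pull_Sym)
  have "gM (mat 1) W W = 0" using assms(3) by (simp add: g W(1) gM_pull matrix_inv_mat_1)
  then have "(W $ 1 $ 1)\<^sup>2 + (W $ 2 $ 2)\<^sup>2 + (W $ 3 $ 3)\<^sup>2 + 2 * (W $ 1 $ 2)\<^sup>2 + 2 * (W $ 1 $ 3)\<^sup>2 + 2 * (W $ 2 $ 3)\<^sup>2 = 0"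
    using W(2) by (simp add: gM_mat_1 mat3_simps Sym_iff power2_eq_square)
  then have "W $ 1 $ 1 = 0" "W $ 2 $ 2 = 0" "W $ 3 $ 3 = 0" "W $ 1 $ 2 = 0" "W $ 1 $ 3 = 0" "W $ 2 $ 3 = 0"
    by (smt (verit) zero_le_power2 power2_eq_square mult_eq_0_iff)+
  then have "W = 0" using W(2) by (simp add: mat3_eq_iff Sym_iff)
  then show ?thesis by (simp add: W(1) pull_linear_simps)
qed

text \<open>By cyclicity of the trace all three Koszul terms equal the same trace up to the factor
  -1/2. Uniqueness follows by testing against the difference of two solutions. The diagonal values
  suffice for the mean curvature.\<close>

lemma christoffel_diag:
  assumes "P \<in> PosDef" "X \<in> Sym"
  shows "christoffel P X X = - (X ** matrix_inv P ** X)"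
proof -
  let ?R = "matrix_inv P"
  note inv = PosDef_invertible[OF assms(1)]
  have RT: "transpose ?R = ?R"
    using matrix_inv_transpose(1)[OF inv] PosDef_Sym[OF assms(1)] by (simp add: Sym_def)
  have G: "- (X ** ?R ** X) \<in> Sym"
    using assms(2) RT by (intro subspace_neg[OF subspace_Sym]) (simp add: Sym_def matrix_transpose_mul matrix_mul_assoc)
  have eq: "gM P (- (X ** ?R ** X)) Z = (dgM P X X Z + dgM P X X Z - dgM P Z X X) / 2" for Z
  proof -
    have 1: "trace (?R ** Z ** ?R ** X ** ?R ** X) = trace (?R ** X ** ?R ** X ** ?R ** Z)"
      using trace_mul_sym[of "?R ** Z" "?R ** X ** ?R ** X"] by (simp add: matrix_mul_assoc)
    have 2: "trace (?R ** X ** ?R ** Z ** ?R ** X) = trace (?R ** X ** ?R ** X ** ?R ** Z)"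
      using trace_mul_sym[of "?R ** X ** ?R ** Z" "?R ** X"] by (simp add: matrix_mul_assoc)
    have 3: "gM P (- (X ** ?R ** X)) Z = - trace (?R ** X ** ?R ** X ** ?R ** Z) / 4"
      by (simp add: gM_def matrix_mult_simps matrix_mul_assoc linear_neg[OF linear_trace])
    show ?thesis unfolding dgM_eq[OF inv] 1 2 3 by simp
  qed
  show ?thesis unfolding christoffel_def
  proof (rule the_equality)
    show "- (X ** ?R ** X) \<in> Sym \<and> (\<forall>Z\<in>Sym. gM P (- (X ** ?R ** X)) Z = (dgM P X X Z + dgM P X X Z - dgM P Z X X) / 2)"
      using G eq by blast
    fix G' assume G': "G' \<in> Sym \<and> (\<forall>Z\<in>Sym. gM P G' Z = (dgM P X X Z + dgM P X X Z - dgM P Z X X) / 2)"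
    have D: "G' - - (X ** ?R ** X) \<in> Sym" using G G' subspace_Sym by (intro subspace_diff) auto
    then have "gM P G' (G' - - (X ** ?R ** X)) = gM P (- (X ** ?R ** X)) (G' - - (X ** ?R ** X))"
      using G' eq by metis
    then have "gM P (G' - - (X ** ?R ** X)) (G' - - (X ** ?R ** X)) = 0"
      by (metis gM_simps(7) diff_self)
    from gM_eq_0_imp[OF assms(1) D this] show "G' = - (X ** ?R ** X)" by (simp add: eq_neg_iff_add_eq_0)
  qed
qed

section \<open>Mean curvature of the orbits\<close>

lemma curve2_linear_image:
  assumes h: "linear h" and "\<And>Q. Q \<in> S \<Longrightarrow> h Q \<in> S'" and "curve2 S P v a"
  shows "curve2 S' (h P) (h v) (h a)"
proof -
  from assms(3) obtain \<gamma> \<gamma>' where g: "\<And>t. \<gamma> t \<in> S" "\<gamma> 0 = P" "\<And>t. (\<gamma> has_vector_derivative \<gamma>' t) (at t)"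
    "\<gamma>' 0 = v" "(\<gamma>' has_vector_derivative a) (at 0)"
    unfolding curve2_def by blast
  have bl: "bounded_linear h" using h by (simp add: linear_conv_bounded_linear)
  show ?thesis unfolding curve2_def
    by (rule exI[of _ "\<lambda>t. h (\<gamma> t)"], rule exI[of _ "\<lambda>t. h (\<gamma>' t)"])
      (auto simp: g assms(2) intro!: bounded_linear.has_vector_derivative[OF bl] g)
qed

text \<open>A linear equation valid on \<open>S\<close> can be differentiated along the curve twice,
  so velocities and accelerations satisfy it too. This bounds tangent spaces from above and shows
  accelerations to be tangent in the linear cases.\<close>

lemma curve2_linear_0:
  fixes h :: "mat3 \<Rightarrow> 'a::euclidean_space"
  assumes h: "linear h" and S: "\<And>Q. Q \<in> S \<Longrightarrow> h Q = 0" and "curve2 S P v a"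
  shows "h v = 0" "h a = 0"
proof -
  from assms(3) obtain \<gamma> \<gamma>' where g: "\<And>t. \<gamma> t \<in> S" "\<gamma> 0 = P" "\<And>t. (\<gamma> has_vector_derivative \<gamma>' t) (at t)"
    "\<gamma>' 0 = v" "(\<gamma>' has_vector_derivative a) (at 0)"
    unfolding curve2_def by blast
  have bl: "bounded_linear h" using h by (simp add: linear_conv_bounded_linear)
  have "((\<lambda>t. h (\<gamma> t)) has_vector_derivative h (\<gamma>' t)) (at t)" for t
    by (rule bounded_linear.has_vector_derivative[OF bl g(3)])
  then have "((\<lambda>t::real. 0) has_vector_derivative h (\<gamma>' t)) (at t)" for t
    using S g(1) by simp
  then have 0: "h (\<gamma>' t) = 0" for t
    using vector_derivative_unique_at has_vector_derivative_const by blast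
  show "h v = 0" using 0[of 0] g by simp
  have "((\<lambda>t. h (\<gamma>' t)) has_vector_derivative h a) (at 0)"
    by (rule bounded_linear.has_vector_derivative[OF bl g(5)])
  then have "((\<lambda>t::real. 0) has_vector_derivative h a) (at 0)" by (simp add: 0)
  then show "h a = 0"
    using vector_derivative_unique_at has_vector_derivative_const by blast
qed

lemma curve2_Sym:
  assumes "S \<subseteq> Sym" "curve2 S P v a" shows "v \<in> Sym" "a \<in> Sym"
proof -
  have l: "linear (\<lambda>A :: mat3. transpose A - A)"
    by (rule linearI) (simp_all add: vec_eq_iff transpose_nth algebra_simps)
  have 0: "transpose Q - Q = 0" if "Q \<in> S" for Q using that assms(1) by (auto simp: Sym_def)
  show "v \<in> Sym" "a \<in> Sym"
    using curve2_linear_0[OF l 0 assms(2)] by (simp_all add: Sym_def)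
qed

lemma tspace_Sym: "S \<subseteq> Sym \<Longrightarrow> tspace S P \<subseteq> Sym"
  using curve2_Sym unfolding tspace_def by blast

definition gM_orthonormal :: "mat3 \<Rightarrow> mat3 list \<Rightarrow> bool" where
  "gM_orthonormal P es \<longleftrightarrow> (\<forall>i<length es. \<forall>j<length es. gM P (es ! i) (es ! j) = (if i = j then 1 else 0))"

lemma gM_orthonormal_projection:
  assumes "gM_orthonormal P es" "u \<in> span (set es)"
  shows "gM P (w - (\<Sum>i<length es. gM P w (es ! i) *\<^sub>R es ! i)) u = 0"
  using assms(2)
proof (induction rule: span_induct)
  case base
  show ?case using linear_gM linear_subspace_kernel by fastforce
next
  case (step x)
  then obtain j where j: "j < length es" "x = es ! j" by (metis in_set_conv_nth)
  have "gM P (\<Sum>i<length es. gM P w (es ! i) *\<^sub>R es ! i) (es ! j)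
      = (\<Sum>i<length es. if i = j then gM P w (es ! i) else 0)"
    unfolding gM_simps using assms(1) j(1) by (intro sum.cong) (auto simp: gM_orthonormal_def)
  also have "\<dots> = gM P w (es ! j)" using j by simp
  finally show ?case by (simp add: gM_simps j)
qed

lemma sum_span_nth: "(\<Sum>i<length es. c i *\<^sub>R es ! i) \<in> span (set es)"
  by (intro span_sum span_scale span_base) simp

text \<open>The remainder lies in the span and is orthogonal to the span, so it has norm
  zero.\<close>

lemma gM_orthonormal_expansion:
  assumes "P \<in> PosDef" "gM_orthonormal P es" "set es \<subseteq> Sym" "u \<in> span (set es)"
  shows "(\<Sum>i<length es. gM P u (es ! i) *\<^sub>R es ! i) = u"
proof -
  let ?d = "u - (\<Sum>i<length es. gM P u (es ! i) *\<^sub>R es ! i)"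
  have d: "?d \<in> span (set es)" by (intro span_diff assms sum_span_nth)
  then have "?d \<in> Sym" using span_minimal[OF assms(3) subspace_Sym] by blast
  moreover have "gM P ?d ?d = 0" using gM_orthonormal_projection[OF assms(2) d] .
  ultimately have "?d = 0" using gM_eq_0_imp assms(1) by blast
  then show ?thesis by simp
qed

lemma gM_orthonormal_parseval:
  assumes "P \<in> PosDef" "gM_orthonormal P es" "set es \<subseteq> Sym" "u \<in> span (set es)"
  shows "(\<Sum>i<length es. gM P u (es ! i) * gM P v (es ! i)) = gM P u v"
proof -
  have "gM P u v = gM P (\<Sum>i<length es. gM P u (es ! i) *\<^sub>R es ! i) v"
    using gM_orthonormal_expansion[OF assms] by simp
  then show ?thesis by (simp add: gM_simps gM_commute[of P _ v])
qed

text \<open>The given orthonormal basis provides an orthogonal projection \<open>p\<close> onto the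
  tangent space, and \<open>w - p\<close> is the unique normal part.\<close>

lemma normal_part_eq_0_iff:
  assumes "P \<in> PosDef" "gM_orthonormal P es" "span (set es) = tspace S P" "S \<subseteq> Sym" "w \<in> Sym"
  shows "normal_part S P w = 0 \<longleftrightarrow> w \<in> tspace S P"
proof -
  define p where "p = (\<Sum>i<length es. gM P w (es ! i) *\<^sub>R es ! i)"
  have T: "tspace S P \<subseteq> Sym" by (rule tspace_Sym[OF assms(4)])
  have es: "set es \<subseteq> Sym" using assms(3) T span_superset[of "set es"] by blast
  have sub: "subspace (tspace S P)" unfolding assms(3)[symmetric] by (rule subspace_span)
  have p: "p \<in> tspace S P" unfolding assms(3)[symmetric] p_def by (rule sum_span_nth)
  have orth: "gM P (w - p) u = 0" if "u \<in> tspace S P" for u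
    unfolding p_def using gM_orthonormal_projection[OF assms(2)] that assms(3) by blast
  have wp: "w - p \<in> Sym" using assms(5) p T by (intro subspace_diff[OF subspace_Sym]) auto
  have eq: "normal_part S P w = w - p"
    unfolding normal_part_def
  proof (rule the_equality)
    show "w - p \<in> Sym \<and> (\<forall>u\<in>tspace S P. gM P (w - p) u = 0) \<and> w - (w - p) \<in> tspace S P"
      using wp orth p by simp
    fix n assume n: "n \<in> Sym \<and> (\<forall>u\<in>tspace S P. gM P n u = 0) \<and> w - n \<in> tspace S P"
    define d where "d = n - (w - p)"
    have "d = p - (w - n)" by (simp add: d_def)
    moreover have "p - (w - n) \<in> tspace S P" using n by (intro subspace_diff[OF sub p]) simp
    ultimately have d: "d \<in> tspace S P" by simp
    have "gM P d d = gM P n d - gM P (w - p) d" by (simp only: d_def gM_simps(7))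
    then have "gM P d d = 0" using n d orth by simp
    then have "d = 0" using gM_eq_0_imp[OF assms(1)] d T by blast
    then show "n = w - p" by (simp add: d_def)
  qed
  show ?thesis
  proof
    assume "normal_part S P w = 0"
    then show "w \<in> tspace S P" using p eq by simp
  next
    assume "w \<in> tspace S P"
    then have "p = w" unfolding p_def
      using gM_orthonormal_expansion[OF assms(1,2) es] assms(3) by simp
    then show "normal_part S P w = 0" by (simp add: eq)
  qed
qed

text \<open>Vanishing mean curvature at one point, with the definite descriptions removed: the
  unprojected sum, with the explicit Christoffel term, has to be tangent.\<close>

definition minimal_at :: "mat3 set \<Rightarrow> mat3 \<Rightarrow> bool" where
  "minimal_at S P \<longleftrightarrow> (\<exists>es as. length as = length es \<and> gM_orthonormal P es \<and>
      span (set es) = tspace S P \<and> (\<forall>i<length es. curve2 S P (es ! i) (as ! i)) \<and>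
      (\<Sum>i<length es. as ! i - es ! i ** matrix_inv P ** es ! i) \<in> tspace S P)"

lemma minimal_submanifold_iff:
  "minimal_submanifold S \<longleftrightarrow> S \<subseteq> PosDef \<and> (\<forall>P\<in>S. minimal_at S P)"
proof (cases "S \<subseteq> PosDef")
  case True
  then have Sym: "S \<subseteq> Sym" using PosDef_Sym by blast
  have "(\<exists>es as. length as = length es \<and>
      (\<forall>i<length es. \<forall>j<length es. gM P (es!i) (es!j) = (if i = j then 1 else 0)) \<and>
      span (set es) = tspace S P \<and>
      (\<forall>i<length es. curve2 S P (es!i) (as!i)) \<and>
      normal_part S P (\<Sum>i<length es. as!i + christoffel P (es!i) (es!i)) = 0) \<longleftrightarrow> minimal_at S P"
    if "P \<in> S" for P
    unfolding minimal_at_def gM_orthonormal_def[symmetric]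
  proof (intro ex_cong1 conj_cong refl)
    fix es as
    assume o: "gM_orthonormal P es" "span (set es) = tspace S P" "\<forall>i<length es. curve2 S P (es ! i) (as ! i)"
    have P: "P \<in> PosDef" using that True by blast
    have sy: "es ! i \<in> Sym" "as ! i \<in> Sym" if "i < length es" for i
      using curve2_Sym[OF Sym] o(3) that by blast+
    have eq: "(\<Sum>i<length es. as!i + christoffel P (es!i) (es!i)) = (\<Sum>i<length es. as ! i - es ! i ** matrix_inv P ** es ! i)"
      using christoffel_diag[OF P] sy by (intro sum.cong) auto
    have RT: "transpose (matrix_inv P) = matrix_inv P"
      using matrix_inv_transpose(1)[OF PosDef_invertible[OF P]] PosDef_Sym[OF P] by (simp add: Sym_def)
    have "as ! i - es ! i ** matrix_inv P ** es ! i \<in> Sym" if "i < length es" for i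
    proof (rule subspace_diff[OF subspace_Sym sy(2)[OF that]])
      show "es ! i ** matrix_inv P ** es ! i \<in> Sym"
        using sy(1)[OF that] RT by (simp add: Sym_def matrix_transpose_mul matrix_mul_assoc)
    qed
    then have "(\<Sum>i<length es. as ! i - es ! i ** matrix_inv P ** es ! i) \<in> Sym"
      by (intro subspace_sum[OF subspace_Sym]) auto
    then show "normal_part S P (\<Sum>i<length es. as!i + christoffel P (es!i) (es!i)) = 0 \<longleftrightarrow>
        (\<Sum>i<length es. as ! i - es ! i ** matrix_inv P ** es ! i) \<in> tspace S P"
      unfolding eq by (rule normal_part_eq_0_iff[OF P o(1,2) Sym])
  qed
  then show ?thesis using True by (simp add: minimal_submanifold_def)
qed (simp add: minimal_submanifold_def)

lemma curve2_pull:
  "curve2 S P v a \<Longrightarrow> curve2 (pull g ` S) (pull g P) (pull g v) (pull g a)"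
  by (rule curve2_linear_image[OF linear_pull]) auto

lemma tspace_pull:
  assumes "invertible g" shows "tspace (pull g ` S) (pull g P) = pull g ` tspace S P"
proof
  show "pull g ` tspace S P \<subseteq> tspace (pull g ` S) (pull g P)"
    using curve2_pull unfolding tspace_def by blast
  show "tspace (pull g ` S) (pull g P) \<subseteq> pull g ` tspace S P"
  proof
    fix v assume "v \<in> tspace (pull g ` S) (pull g P)"
    then obtain a where "curve2 (pull g ` S) (pull g P) v a" unfolding tspace_def by blast
    from curve2_pull[OF this, of "matrix_inv g"]
    have "curve2 S P (pull (matrix_inv g) v) (pull (matrix_inv g) a)"
      by (simp add: image_image pull_inverse assms)
    then have "pull (matrix_inv g) v \<in> tspace S P" unfolding tspace_def by blast
    then show "v \<in> pull g ` tspace S P"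
      by (metis imageI pull_inverse(2)[OF assms])
  qed
qed

text \<open>Every ingredient is equivariant: \<open>pull g\<close> is linear, so it maps velocities
  and accelerations alike, it is an isometry, and it commutes with forming
  \<open>e ** matrix_inv P ** e\<close>.\<close>

lemma minimal_at_pull:
  assumes "invertible g" "invertible P" "minimal_at S P"
  shows "minimal_at (pull g ` S) (pull g P)"
proof -
  from assms(3) obtain es as where o: "length as = length es" "gM_orthonormal P es"
    "span (set es) = tspace S P" "\<forall>i<length es. curve2 S P (es ! i) (as ! i)"
    "(\<Sum>i<length es. as ! i - es ! i ** matrix_inv P ** es ! i) \<in> tspace S P"
    unfolding minimal_at_def by blast
  note inv = assms(1,2) matrix_inv_transpose(2)[OF assms(1)] invertible_mult
  have R: "matrix_inv (pull g P) = matrix_inv g ** matrix_inv P ** matrix_inv (transpose g)"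
    unfolding pull_def by (simp add: inv matrix_inv_mult matrix_mul_assoc)
  have "pull g e ** matrix_inv (pull g P) ** pull g e = pull g (e ** matrix_inv P ** e)" for e
    unfolding R unfolding pull_def by (simp add: matrix_mul_assoc matrix_inv_cancel inv)
  then have "(\<Sum>i<length es. map (pull g) as ! i - map (pull g) es ! i ** matrix_inv (pull g P) ** map (pull g) es ! i)
      = pull g (\<Sum>i<length es. as ! i - es ! i ** matrix_inv P ** es ! i)"
    using o(1) by (auto simp: pull_linear_simps intro!: sum.cong)
  then show ?thesis
    unfolding minimal_at_def
    using o gM_pull[OF assms(1,2)] linear_span_image[OF linear_pull, of g "set es"]
    by (intro exI[of _ "map (pull g) es"] exI[of _ "map (pull g) as"])
      (auto simp: gM_orthonormal_def curve2_pull tspace_pull assms)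
qed

section \<open>Metric classes as orbits of scaled automorphisms\<close>

lemma lie_aut_comp: "f \<in> lie_aut br \<Longrightarrow> h \<in> lie_aut br \<Longrightarrow> f ** h \<in> lie_aut br"
  by (simp add: lie_aut_def invertible_mult matrix_vector_mul_assoc[symmetric])

lemma lie_aut_inverse:
  assumes "f \<in> lie_aut br" shows "matrix_inv f \<in> lie_aut br"
proof -
  have inv: "invertible f" and br: "\<And>x y. f *v br x y = br (f *v x) (f *v y)"
    using assms by (auto simp: lie_aut_def)
  have "matrix_inv f *v br x y = br (matrix_inv f *v x) (matrix_inv f *v y)" for x y
    using br[of "matrix_inv f *v x" "matrix_inv f *v y"]
    by (metis inv matrix_inv_cancel(5,6))
  then show ?thesis by (simp add: lie_aut_def inv matrix_inv_matrix_inv)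
qed

lemma lie_aut_1: "mat 1 \<in> lie_aut br"
  by (simp add: lie_aut_def matrix_inv_mat_1)

text \<open>Scaling by \<open>k\<close> is the pullback along a multiple of the identity by
  \<open>sqrt k\<close>, so positive definiteness is automatic and the class is an orbit.\<close>

lemma metric_class_eq:
  assumes "P \<in> PosDef"
  shows "metric_class br P = {k *\<^sub>R pull f P | k f. k > 0 \<and> f \<in> lie_aut br}"
proof -
  have *: "(\<forall>x y. ip Q x y = k * ip P (f *v x) (f *v y)) \<longleftrightarrow> Q = k *\<^sub>R pull f P" for Q k f
  proof -
    have "ip (k *\<^sub>R A) x y = k * ip A x y" for A x y
      by (simp add: ip_def scaleR_matrix_vector_assoc[symmetric])
    then have "ip (k *\<^sub>R pull f P) x y = k * ip P (f *v x) (f *v y)" for x y by (simp add: ip_pull)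
    then show ?thesis using ip_ext[of Q "k *\<^sub>R pull f P"] by auto
  qed
  have pd: "k *\<^sub>R pull f P \<in> PosDef" if "k > 0" "f \<in> lie_aut br" for k f
  proof -
    have "k *\<^sub>R pull f P = pull (sqrt k *\<^sub>R f) P"
      using that(1) by (simp add: pull_def transpose_scalar matrix_mult_simps)
    moreover have "invertible (sqrt k *\<^sub>R f)"
      using that by (intro scalar_invertible) (auto simp: lie_aut_def)
    ultimately show ?thesis using pull_PosDef assms by simp
  qed
  show ?thesis unfolding metric_class_def * using pd by blast
qed

lemma metric_class_subset_PosDef: "metric_class br P \<subseteq> PosDef"
  by (auto simp: metric_class_def)

lemma metric_class_pull:
  assumes "P \<in> PosDef" "f \<in> lie_aut br" "k > 0"
  shows "pull (sqrt k *\<^sub>R f) ` metric_class br P = metric_class br P"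
proof -
  have sc: "pull (sqrt k *\<^sub>R f) Q = k *\<^sub>R pull f Q" if "k > 0" for k f Q
    using that by (simp add: pull_def transpose_scalar matrix_mult_simps)
  have sub: "pull (sqrt k *\<^sub>R f) ` metric_class br P \<subseteq> metric_class br P"
    if "f \<in> lie_aut br" "k > 0" for k f
    unfolding metric_class_eq[OF assms(1)] sc[OF that(2)]
  proof clarify
    fix k' f' assume "k' > (0::real)" "f' \<in> lie_aut br"
    then show "\<exists>ka fa. k *\<^sub>R pull f (k' *\<^sub>R pull f' P) = ka *\<^sub>R pull fa P \<and> 0 < ka \<and> fa \<in> lie_aut br"
      using that by (intro exI[of _ "k * k'"] exI[of _ "f' ** f"])
        (simp add: pull_linear_simps pull_mult lie_aut_comp)
  qed
  have inv: "invertible f" using assms(2) by (simp add: lie_aut_def)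
  have "Q \<in> pull (sqrt k *\<^sub>R f) ` metric_class br P" if "Q \<in> metric_class br P" for Q
  proof
    have "pull (sqrt (1 / k) *\<^sub>R matrix_inv f) Q \<in> pull (sqrt (1 / k) *\<^sub>R matrix_inv f) ` metric_class br P"
      using that by blast
    then show "pull (sqrt (1 / k) *\<^sub>R matrix_inv f) Q \<in> metric_class br P"
      using sub[OF lie_aut_inverse[OF assms(2)], of "1 / k"] assms(3) by auto
    show "Q = pull (sqrt k *\<^sub>R f) (pull (sqrt (1 / k) *\<^sub>R matrix_inv f) Q)"
      using assms(3) inv by (simp add: sc pull_linear_simps pull_inverse)
  qed
  then show ?thesis using sub[OF assms(2,3)] by blast
qed

text \<open>Scaled automorphisms act by isometries, map the class onto itself and carry
  \<open>P\<close> to any other point of it.\<close>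

lemma minimal_metric_class_iff:
  assumes "P \<in> PosDef"
  shows "minimal_submanifold (metric_class br P) \<longleftrightarrow> minimal_at (metric_class br P) P"
proof
  have "P \<in> metric_class br P"
    unfolding metric_class_eq[OF assms] using lie_aut_1 by (auto intro!: exI[of _ 1] exI[of _ "mat 1"])
  then show "minimal_submanifold (metric_class br P) \<Longrightarrow> minimal_at (metric_class br P) P"
    by (simp add: minimal_submanifold_iff)
next
  assume m: "minimal_at (metric_class br P) P"
  have "minimal_at (metric_class br P) Q" if Q: "Q \<in> metric_class br P" for Q
  proof -
    obtain k f where kf: "k > 0" "f \<in> lie_aut br" "Q = k *\<^sub>R pull f P"
      using Q unfolding metric_class_eq[OF assms] by blast
    have "Q = pull (sqrt k *\<^sub>R f) P"
      using kf by (simp add: pull_def transpose_scalar matrix_mult_simps)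
    moreover have "invertible (sqrt k *\<^sub>R f)"
      using kf by (intro scalar_invertible) (auto simp: lie_aut_def)
    ultimately show ?thesis
      using minimal_at_pull[OF _ PosDef_invertible[OF assms] m] metric_class_pull[OF assms kf(2,1)] by metis
  qed
  then show "minimal_submanifold (metric_class br P)"
    using metric_class_subset_PosDef by (simp add: minimal_submanifold_iff)
qed

lemma lie_aut_transport:
  assumes g: "invertible g" and f: "f \<in> lie_aut br"
  shows "matrix_inv g ** f ** g \<in> lie_aut (transport g br)"
proof -
  have "invertible f" and br: "\<And>x y. f *v br x y = br (f *v x) (f *v y)"
    using f by (auto simp: lie_aut_def)
  then have "invertible (matrix_inv g ** f ** g)"
    by (simp add: invertible_mult g matrix_inv_matrix_inv)
  then show ?thesis
    by (simp add: lie_aut_def transport_def matrix_vector_mul_assoc[symmetric] matrix_inv_cancel g br)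
qed

lemma transport_inverse:
  assumes "invertible g" shows "transport (matrix_inv g) (transport g br) = br"
  by (intro ext) (simp add: transport_def matrix_inv_cancel matrix_inv_matrix_inv assms)

lemma metric_class_transport_subset:
  assumes g: "invertible g" and P: "P \<in> PosDef"
  shows "pull g ` metric_class br P \<subseteq> metric_class (transport g br) (pull g P)"
  unfolding metric_class_eq[OF P] metric_class_eq[OF pull_PosDef[OF g P]]
proof clarify
  fix k f assume "k > (0::real)" "f \<in> lie_aut br"
  then show "\<exists>ka fa. pull g (k *\<^sub>R pull f P) = ka *\<^sub>R pull fa (pull g P) \<and> 0 < ka \<and> fa \<in> lie_aut (transport g br)"
    using lie_aut_transport[OF g] g
    by (intro exI[of _ k] exI[of _ "matrix_inv g ** f ** g"])
      (simp add: pull_linear_simps pull_mult matrix_mul_assoc matrix_inv_cancel)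
qed

text \<open>Conjugation by \<open>g\<close> identifies the two automorphism groups; the reverse
  inclusion is the forward one applied to the inverse of \<open>g\<close>.\<close>

lemma metric_class_transport:
  assumes g: "invertible g" and P: "P \<in> PosDef"
  shows "metric_class (transport g br) (pull g P) = pull g ` metric_class br P"
proof
  have "pull (matrix_inv g) ` metric_class (transport g br) (pull g P) \<subseteq> metric_class br P"
    using metric_class_transport_subset[OF matrix_inv_matrix_inv(2)[OF g] pull_PosDef[OF g P], of "transport g br"]
    by (simp add: transport_inverse pull_inverse g)
  then have "pull g ` pull (matrix_inv g) ` metric_class (transport g br) (pull g P) \<subseteq> pull g ` metric_class br P"
    by (rule image_mono)
  then show "metric_class (transport g br) (pull g P) \<subseteq> pull g ` metric_class br P"
    by (simp add: image_image pull_inverse g)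
qed (rule metric_class_transport_subset[OF g P])

lemma minimal_transport_imp:
  assumes g: "invertible g" and P: "P \<in> PosDef" and "minimal_submanifold (metric_class br P)"
  shows "minimal_submanifold (metric_class (transport g br) (pull g P))"
proof -
  have "minimal_at (pull g ` metric_class br P) (pull g P)"
    using assms(3) minimal_at_pull[OF g PosDef_invertible[OF P]] minimal_metric_class_iff[OF P] by blast
  then show ?thesis
    unfolding minimal_metric_class_iff[OF pull_PosDef[OF g P]] unfolding metric_class_transport[OF g P] .
qed

lemma minimal_transport:
  assumes g: "invertible g" and P: "P \<in> PosDef"
  shows "minimal_submanifold (metric_class (transport g br) (pull g P)) \<longleftrightarrow> minimal_submanifold (metric_class br P)"
  using minimal_transport_imp[OF g P]
    minimal_transport_imp[OF matrix_inv_matrix_inv(2)[OF g] pull_PosDef[OF g P], of "transport g br"]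
  by (auto simp: transport_inverse pull_inverse g)

section \<open>Ricci curvature\<close>

text \<open>Lets the connection be found by guessing a vector and checking the Koszul
  formula.\<close>

lemma lc_nabla_unique:
  assumes "P \<in> PosDef"
    "\<And>z. ip P v z = (ip P (br x y) z - ip P (br y z) x + ip P (br z x) y) / 2"
  shows "lc_nabla br P x y = v"
  unfolding lc_nabla_def
proof (rule the_equality)
  fix w assume "\<forall>z. ip P w z = (ip P (br x y) z - ip P (br y z) x + ip P (br z x) y) / 2"
  then have "ip P w z = ip P v z" for z using assms(2)[of z] by metis
  then show "w = v" using PosDef_ip_eq_iff[OF assms(1), of w v] by blast
qed (use assms(2) in blast)

lemma lc_nabla_koszul:
  assumes "P \<in> PosDef" "bilinear br"
  shows "ip P (lc_nabla br P x y) z = (ip P (br x y) z - ip P (br y z) x + ip P (br z x) y) / 2"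
proof -
  have "linear (\<lambda>z. (ip P (br x y) z - ip P (br y z) x + ip P (br z x) y) / 2)"
    by (rule linearI) (simp_all add: ip_linear_simps bilinear_ladd[OF assms(2)] bilinear_radd[OF assms(2)]
        bilinear_lmul[OF assms(2)] bilinear_rmul[OF assms(2)] field_simps)
  from PosDef_riesz[OF assms(1) this] obtain v
    where v: "\<And>z. ip P v z = (ip P (br x y) z - ip P (br y z) x + ip P (br z x) y) / 2" by blast
  show ?thesis using v lc_nabla_unique[OF assms(1) v] by simp
qed

lemma bilinear_lc_nabla:
  assumes "P \<in> PosDef" "bilinear br" shows "bilinear (lc_nabla br P)"
proof -
  note k = lc_nabla_koszul[OF assms]
  note bl = bilinear_ladd[OF assms(2)] bilinear_radd[OF assms(2)]
        bilinear_lmul[OF assms(2)] bilinear_rmul[OF assms(2)]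
  have "linear (\<lambda>x. lc_nabla br P x y)" "linear (lc_nabla br P y)" for y
    by (rule linearI; subst PosDef_ip_eq_iff[OF assms(1), symmetric];
        simp add: k ip_linear_simps bl field_simps)+
  then show ?thesis by (simp add: bilinear_def)
qed

lemma bilinear_transport:
  assumes "bilinear br" shows "bilinear (transport g br)"
  unfolding bilinear_def transport_def
  by (auto intro!: linearI simp: matrix_vector_right_distrib matrix_vector_mult_scaleR
     bilinear_ladd[OF assms] bilinear_radd[OF assms] bilinear_lmul[OF assms] bilinear_rmul[OF assms])

lemma lc_nabla_transport:
  assumes "P \<in> PosDef" "bilinear br" "invertible g"
  shows "lc_nabla (transport g br) (pull g P) = transport g (lc_nabla br P)"
  by (intro ext lc_nabla_unique pull_PosDef assms)
    (simp add: ip_pull transport_def matrix_inv_cancel assms lc_nabla_koszul)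

lemma curv_transport:
  assumes "P \<in> PosDef" "bilinear br" "invertible g"
  shows "curv (transport g br) (pull g P) x y z = matrix_inv g *v curv br P (g *v x) (g *v y) (g *v z)"
  by (simp add: curv_def lc_nabla_transport assms)
    (simp add: transport_def matrix_inv_cancel assms matrix_vector_mult_diff_distrib)

lemma linear_curv:
  assumes "P \<in> PosDef" "bilinear br"
  shows "linear (\<lambda>x. curv br P x y z)"
proof -
  note b = assms(2) and n = bilinear_lc_nabla[OF assms]
  show ?thesis unfolding curv_def
    by (rule linearI) (simp_all add: bilinear_ladd[OF b] bilinear_radd[OF b] bilinear_lmul[OF b] bilinear_rmul[OF b]
        bilinear_ladd[OF n] bilinear_radd[OF n] bilinear_lmul[OF n] bilinear_rmul[OF n] algebra_simps)
qed

text \<open>The Ricci tensor is the trace of the linear map \<open>x\<close> to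
  \<open>curv br P x y z\<close>, written in the standard basis. Transport conjugates this map by
  \<open>g\<close>, which leaves the trace unchanged.\<close>

lemma ric_tensor_transport:
  assumes "P \<in> PosDef" "bilinear br" "invertible g"
  shows "ric_tensor (transport g br) (pull g P) y z = ric_tensor br P (g *v y) (g *v z)"
proof -
  let ?C = "matrix (\<lambda>x. curv br P x (g *v y) (g *v z))"
  have C: "?C *v x = curv br P x (g *v y) (g *v z)" for x
    using matrix_vector_mul(2)[OF linear_curv[OF assms(1,2)]] by metis
  have tr: "(\<Sum>i\<in>UNIV. (A *v axis i 1) $ i) = trace A" for A :: mat3
    by (simp add: trace_def matrix_vector_mult_basis column_def)
  have "ric_tensor (transport g br) (pull g P) y z = trace (matrix_inv g ** (?C ** g))"
    unfolding tr[symmetric] by (simp add: ric_tensor_def curv_transport assms C matrix_vector_mul_assoc[symmetric])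
  also have "\<dots> = trace ?C"
    by (subst trace_mul_sym) (simp add: matrix_inv_cancel assms)
  also have "\<dots> = ric_tensor br P (g *v y) (g *v z)"
    unfolding tr[symmetric] by (simp add: ric_tensor_def C)
  finally show ?thesis .
qed

lemma ricci_op_unique:
  assumes "P \<in> PosDef" "\<And>w. ip P v w = ric_tensor br P x w"
  shows "ricci_op br P x = v"
  unfolding ricci_op_def
proof (rule the_equality)
  fix u assume "\<forall>w. ip P u w = ric_tensor br P x w"
  then have "ip P u w = ip P v w" for w using assms(2)[of w] by simp
  then show "u = v" using PosDef_ip_eq_iff[OF assms(1), of u v] by blast
qed (use assms(2) in blast)

lemma ricci_op_works:
  assumes "P \<in> PosDef" "bilinear br"
  shows "ip P (ricci_op br P x) w = ric_tensor br P x w"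
proof -
  note b = assms(2) and n = bilinear_lc_nabla[OF assms]
  have "linear (ric_tensor br P x)" unfolding ric_tensor_def curv_def
    by (rule linearI) (simp_all add: bilinear_ladd[OF b] bilinear_radd[OF b] bilinear_lmul[OF b] bilinear_rmul[OF b]
        bilinear_ladd[OF n] bilinear_radd[OF n] bilinear_lmul[OF n] bilinear_rmul[OF n] algebra_simps
        sum.distrib sum_distrib_left sum_subtractf)
  from PosDef_riesz[OF assms(1) this] obtain v where v: "\<And>w. ip P v w = ric_tensor br P x w" by blast
  show ?thesis using v ricci_op_unique[OF assms(1) v] by simp
qed

lemma ricci_op_transport:
  assumes "P \<in> PosDef" "bilinear br" "invertible g"
  shows "ricci_op (transport g br) (pull g P) x = matrix_inv g *v ricci_op br P (g *v x)"
  by (intro ricci_op_unique pull_PosDef assms)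
    (simp add: ip_pull matrix_inv_cancel assms ricci_op_works ric_tensor_transport)

lemma solvsoliton_transport_imp:
  assumes "P \<in> PosDef" "bilinear br" "invertible g" "solvsoliton br P"
  shows "solvsoliton (transport g br) (pull g P)"
proof -
  from assms(4) obtain c D where D: "is_derivation br D" "\<And>x. ricci_op br P x = c *\<^sub>R x + D *v x"
    unfolding solvsoliton_def by blast
  have "is_derivation (transport g br) (matrix_inv g ** D ** g)"
    using D(1) by (simp add: is_derivation_def transport_def matrix_vector_mul_assoc[symmetric]
        matrix_inv_cancel assms matrix_vector_right_distrib)
  moreover have "ricci_op (transport g br) (pull g P) x = c *\<^sub>R x + (matrix_inv g ** D ** g) *v x" for x
    by (simp add: ricci_op_transport assms(1-3) D(2) matrix_vector_right_distrib matrix_vector_mult_scaleR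
        matrix_vector_mul_assoc[symmetric] matrix_inv_cancel)
  ultimately show ?thesis unfolding solvsoliton_def by blast
qed

lemma solvsoliton_transport:
  assumes "P \<in> PosDef" "bilinear br" "invertible g"
  shows "solvsoliton (transport g br) (pull g P) \<longleftrightarrow> solvsoliton br P"
  using solvsoliton_transport_imp[OF assms]
    solvsoliton_transport_imp[OF pull_PosDef[OF assms(3,1)] bilinear_transport[OF assms(2)] matrix_inv_matrix_inv(2)[OF assms(3)], of g]
  by (auto simp: transport_inverse pull_inverse assms)

text \<open>\<open>[e\<^sub>1, v] = A v\<close> with \<open>A = ((t, a), (b, t))\<close> acting on the abelian ideal spanned by \<open>e\<^sub>2, e\<^sub>3\<close>.\<close>

definition semidirect :: "real \<Rightarrow> real \<Rightarrow> real \<Rightarrow> vec3 \<Rightarrow> vec3 \<Rightarrow> vec3" where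
  "semidirect t a b x y = vector [0,
     t * (x $ 1 * y $ 2 - x $ 2 * y $ 1) + a * (x $ 1 * y $ 3 - x $ 3 * y $ 1),
     b * (x $ 1 * y $ 2 - x $ 2 * y $ 1) + t * (x $ 1 * y $ 3 - x $ 3 * y $ 1)]"

lemma vec3_eq_iff: "(x :: vec3) = y \<longleftrightarrow> x $ 1 = y $ 1 \<and> x $ 2 = y $ 2 \<and> x $ 3 = y $ 3"
  by (simp add: vec_eq_iff forall_3)

lemma semidirect_nth [simp]:
  "semidirect t a b x y $ 1 = 0"
  "semidirect t a b x y $ 2 = t * (x $ 1 * y $ 2 - x $ 2 * y $ 1) + a * (x $ 1 * y $ 3 - x $ 3 * y $ 1)"
  "semidirect t a b x y $ 3 = b * (x $ 1 * y $ 2 - x $ 2 * y $ 1) + t * (x $ 1 * y $ 3 - x $ 3 * y $ 1)"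
  by (simp_all add: semidirect_def vector_3)

text \<open>Let \<open>S\<close> and \<open>K\<close> be the symmetric and skew parts of
  \<open>A\<close>, and let primes denote components in the ideal. The first entry is the inner
  product of \<open>S x'\<close> with \<open>y'\<close>, and the other two form
  \<open>x\<^sub>1 K y' - y\<^sub>1 S x'\<close>.\<close>

lemma lc_nabla_semidirect:
  "lc_nabla (semidirect t a b) (mat 1) x y = vector [
     (t * x $ 2 + (a + b) / 2 * x $ 3) * y $ 2 + ((a + b) / 2 * x $ 2 + t * x $ 3) * y $ 3,
     x $ 1 * ((a - b) / 2 * y $ 3) - y $ 1 * (t * x $ 2 + (a + b) / 2 * x $ 3),
     x $ 1 * ((b - a) / 2 * y $ 2) - y $ 1 * ((a + b) / 2 * x $ 2 + t * x $ 3)]"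
  by (rule lc_nabla_unique[OF mat_1_PosDef]) (simp add: ip_def inner_vec3 vector_3 field_simps)

text \<open>The corner entry is minus the trace of the square of \<open>S\<close>, the symmetric
  part of \<open>A\<close>; the block on the ideal is minus the trace of \<open>A\<close> times
  \<open>S\<close>, plus half the commutator of \<open>A\<close> with its transpose.\<close>

lemma ricci_op_semidirect:
  "ricci_op (semidirect t a b) (mat 1) x = m33
     (- 2 * t\<^sup>2 - (a + b)\<^sup>2 / 2) 0 0
     0 (- 2 * t\<^sup>2 + (a\<^sup>2 - b\<^sup>2) / 2) (- t * (a + b))
     0 (- t * (a + b)) (- 2 * t\<^sup>2 - (a\<^sup>2 - b\<^sup>2) / 2) *v x"
  by (rule ricci_op_unique[OF mat_1_PosDef])
    (simp add: ip_def inner_vec3 vector_3 mat3_vec_nth ric_tensor_def curv_def lc_nabla_semidirect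
      sum_3 axis_def power2_eq_square field_simps)

text \<open>With \<open>B\<close> the lower block of the matrix, the condition is
  \<open>B A - A B = d A\<close>. The diagonal entries on the left are opposite while those on the
  right are both \<open>d t\<close>, which splits them into \<open>e * b = e * a\<close> and
  \<open>d * t = 0\<close>. The shape of the matrix is that of the Ricci operator minus a
  scalar.\<close>

lemma is_derivation_semidirect_iff:
  "is_derivation (semidirect t a b) (m33 d 0 0 0 p e 0 e q) \<longleftrightarrow>
    e * b = e * a \<and> d * t = 0 \<and> a * (p - q) = d * a \<and> b * (q - p) = d * b" (is "is_derivation ?br ?D \<longleftrightarrow> ?R")
proof
  assume "is_derivation ?br ?D"
  then have D: "?D *v ?br (axis 1 1) y = ?br (?D *v axis 1 1) y + ?br (axis 1 1) (?D *v y)" for y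
    by (simp add: is_derivation_def)
  have "p * t + e * b = t * (d + p) + a * e" "e * t + q * b = b * (d + p) + t * e"
    using D[of "axis 2 1"] by (simp_all add: vec3_eq_iff mat3_vec_nth axis_def algebra_simps)
  moreover have "p * a + e * t = a * (d + q) + t * e" "e * a + q * t = b * e + t * (d + q)"
    using D[of "axis 3 1"] by (simp_all add: vec3_eq_iff mat3_vec_nth axis_def algebra_simps)
  ultimately show ?R by (simp add: algebra_simps)
next
  assume ?R
  then have "e * b = e * a" "d * t = 0" "a * p - a * q = d * a" "b * q - b * p = d * b"
    by (simp_all add: algebra_simps)
  then show "is_derivation ?br ?D"
    unfolding is_derivation_def vec3_eq_iff
    by (simp add: mat3_vec_nth) algebra
qed

text \<open>The derivation is forced to be the Ricci operator minus \<open>c\<close>. As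
  \<open>c\<close> varies, its corner entry \<open>d\<close> takes every real value, so
  \<open>c\<close> can be traded for \<open>d\<close>.\<close>

lemma solvsoliton_semidirect_iff:
  "solvsoliton (semidirect t a b) (mat 1) \<longleftrightarrow> a\<^sup>2 = b\<^sup>2 \<or> (t = 0 \<and> a * b = 0)"
proof -
  let ?D = "\<lambda>c. m33
     (- 2 * t\<^sup>2 - (a + b)\<^sup>2 / 2 - c) 0 0
     0 (- 2 * t\<^sup>2 + (a\<^sup>2 - b\<^sup>2) / 2 - c) (- t * (a + b))
     0 (- t * (a + b)) (- 2 * t\<^sup>2 - (a\<^sup>2 - b\<^sup>2) / 2 - c)"
  have "(\<forall>x. ricci_op (semidirect t a b) (mat 1) x = c *\<^sub>R x + D *v x) \<longleftrightarrow> D = ?D c" for c D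
  proof -
    have "ricci_op (semidirect t a b) (mat 1) x = c *\<^sub>R x + ?D c *v x" for x
      by (simp add: ricci_op_semidirect vec3_eq_iff mat3_vec_nth algebra_simps)
    then show ?thesis by (auto simp: matrix_eq)
  qed
  then have "solvsoliton (semidirect t a b) (mat 1) \<longleftrightarrow> (\<exists>c. is_derivation (semidirect t a b) (?D c))"
    unfolding solvsoliton_def by auto
  also have "\<dots> \<longleftrightarrow> (\<exists>c. t * (b\<^sup>2 - a\<^sup>2) = 0 \<and> (- 2 * t\<^sup>2 - (a + b)\<^sup>2 / 2 - c) * t = 0 \<and>
      a * (a\<^sup>2 - b\<^sup>2) = (- 2 * t\<^sup>2 - (a + b)\<^sup>2 / 2 - c) * a \<and> b * (b\<^sup>2 - a\<^sup>2) = (- 2 * t\<^sup>2 - (a + b)\<^sup>2 / 2 - c) * b)"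
    unfolding is_derivation_semidirect_iff
    by (intro ex_cong1 conj_cong refl) (auto simp: algebra_simps power2_eq_square)
  also have "\<dots> \<longleftrightarrow> (\<exists>d. t * (b\<^sup>2 - a\<^sup>2) = 0 \<and> d * t = 0 \<and> a * (a\<^sup>2 - b\<^sup>2) = d * a \<and> b * (b\<^sup>2 - a\<^sup>2) = d * b)"
    (is "(\<exists>c. ?P (?k - c)) \<longleftrightarrow> (\<exists>d. ?P d)")
  proof -
    have "?P d \<Longrightarrow> ?P (?k - (?k - d))" for d by simp
    then show ?thesis by blast
  qed
  also have "\<dots> \<longleftrightarrow> a\<^sup>2 = b\<^sup>2 \<or> (t = 0 \<and> a * b = 0)"
  proof (cases "a\<^sup>2 = b\<^sup>2")
    case True
    then show ?thesis by (auto intro!: exI[of _ 0])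
  next
    case False
    have "t = 0 \<and> a * b = 0" if "t * (b\<^sup>2 - a\<^sup>2) = 0" "a * (a\<^sup>2 - b\<^sup>2) = d * a" "b * (b\<^sup>2 - a\<^sup>2) = d * b" for d
    proof
      show "t = 0" using False that(1) by simp
      have "2 * (a * b) * (a\<^sup>2 - b\<^sup>2) = b * (a * (a\<^sup>2 - b\<^sup>2)) - a * (b * (b\<^sup>2 - a\<^sup>2))" by (simp add: algebra_simps)
      also have "\<dots> = 0" unfolding that(2,3) by simp
      finally show "a * b = 0" using False by simp
    qed
    moreover have "\<exists>d. a * (a\<^sup>2 - b\<^sup>2) = d * a \<and> b * (b\<^sup>2 - a\<^sup>2) = d * b" if "a * b = 0"
      using that by (auto intro: exI[of _ "b\<^sup>2 - a\<^sup>2"] exI[of _ "a\<^sup>2 - b\<^sup>2"])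
    ultimately show ?thesis using False by auto
  qed
  finally show ?thesis .
qed


section \<open>Tangent vectors and minimality at the identity\<close>

text \<open>\<open>curve2\<close> asks for curves on the whole real line, but the identity plus
  \<open>t X\<close> may become singular. A quadratic term cures this without changing the velocity
  at 0: with \<open>K\<close> a bound for the norm of \<open>X\<close>, the square of
  \<open>K\<close> works because \<open>1 + y\<^sup>2 > y\<close>.\<close>

lemma invertible_quadratic_perturbation:
  fixes X :: "real^'n^'n"
  obtains c where "\<And>t. invertible ((1 + c * t\<^sup>2) *\<^sub>R mat 1 + t *\<^sub>R X)"
proof -
  obtain K where K: "K > 0" "\<And>x. norm (X *v x) \<le> norm x * K"
    using bounded_linear.pos_bounded[OF matrix_vector_mul_bounded_linear[of X]] by blast
  have "invertible ((1 + K\<^sup>2 * t\<^sup>2) *\<^sub>R mat 1 + t *\<^sub>R X)" for t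
  proof -
    let ?M = "(1 + K\<^sup>2 * t\<^sup>2) *\<^sub>R mat 1 + t *\<^sub>R X"
    have "x = 0" if "?M *v x = 0" for x
    proof (rule ccontr)
      assume "x \<noteq> 0"
      have "(1 + K\<^sup>2 * t\<^sup>2) *\<^sub>R x = - (t *\<^sub>R (X *v x))"
        using that by (simp add: matrix_vector_mult_add_rdistrib scaleR_matrix_vector_assoc[symmetric] eq_neg_iff_add_eq_0)
      then have "norm ((1 + K\<^sup>2 * t\<^sup>2) *\<^sub>R x) = \<bar>t\<bar> * norm (X *v x)" by simp
      then have "(1 + K\<^sup>2 * t\<^sup>2) * norm x \<le> \<bar>t\<bar> * (norm x * K)"
        using K(2)[of x] mult_left_mono[of "norm (X *v x)" "norm x * K" "\<bar>t\<bar>"]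
        by (simp add: abs_of_nonneg)
      then have "(1 + K\<^sup>2 * t\<^sup>2) * norm x \<le> (\<bar>t\<bar> * K) * norm x" by (simp add: mult_ac)
      then have "1 + (K * \<bar>t\<bar>)\<^sup>2 \<le> K * \<bar>t\<bar>"
        using \<open>x \<noteq> 0\<close> by (simp add: power_mult_distrib mult.commute)
      moreover have "1 + y\<^sup>2 > y" for y :: real
        using zero_le_power2[of "y - 1 / 2"] by (simp add: power2_diff field_simps)
      ultimately show False by (meson not_le)
    qed
    then show ?thesis using invertible_left_inverse matrix_left_invertible_ker by blast
  qed
  then show thesis by (rule that)
qed

text \<open>The curve consists of the Gram matrices of the everywhere invertible path from
  \<open>invertible_quadratic_perturbation\<close>; its velocity at 0 is
  \<open>X + transpose X\<close>.\<close>

lemma tspace_gram_curve: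
  assumes "\<And>p q. invertible (p *\<^sub>R mat 1 + q *\<^sub>R X) \<Longrightarrow> pull (p *\<^sub>R mat 1 + q *\<^sub>R X) (mat 1) \<in> S"
  shows "X + transpose X \<in> tspace S (mat 1)"
proof -
  obtain c where c: "\<And>t. invertible ((1 + c * t\<^sup>2) *\<^sub>R mat 1 + t *\<^sub>R X)"
    using invertible_quadratic_perturbation[of X] by blast
  let ?g = "\<lambda>t. (1 + c * t\<^sup>2)\<^sup>2 *\<^sub>R mat 1 + (t + c * t ^ 3) *\<^sub>R (X + transpose X) + t\<^sup>2 *\<^sub>R (transpose X ** X)"
  let ?d = "\<lambda>t. (2 * (1 + c * t\<^sup>2) * (2 * c * t)) *\<^sub>R mat 1 + (1 + 3 * c * t\<^sup>2) *\<^sub>R (X + transpose X) + (2 * t) *\<^sub>R (transpose X ** X)"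
  have eq: "pull ((1 + c * t\<^sup>2) *\<^sub>R mat 1 + t *\<^sub>R X) (mat 1) = ?g t" for t
    by (simp add: pull_def mat3_eq_iff mat3_simps power2_eq_square power3_eq_cube algebra_simps)
  have "curve2 S (mat 1) (X + transpose X) ((4 * c) *\<^sub>R mat 1 + 2 *\<^sub>R (transpose X ** X))"
    unfolding curve2_def
  proof (intro exI conjI allI)
    show "?g t \<in> S" for t using assms[OF c] by (simp only: eq)
    show "?g 0 = mat 1" by simp
    show "(?g has_vector_derivative ?d t) (at t)" for t
      by (auto intro!: derivative_eq_intros simp: power2_eq_square algebra_simps)
    show "?d 0 = X + transpose X" by simp
    show "(?d has_vector_derivative (4 * c) *\<^sub>R mat 1 + 2 *\<^sub>R (transpose X ** X)) (at 0)"
      by (auto intro!: derivative_eq_intros)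
  qed
  then show ?thesis unfolding tspace_def by blast
qed

text \<open>Orthonormal for \<open>gM (mat 1)\<close>, and ordered so that the first 4, 5 or 6
  members span the tangent spaces of the minimal model orbits.\<close>

definition sym_basis :: "mat3 list" where
  "sym_basis = [m33 2 0 0 0 0 0 0 0 0,
    m33 0 0 0 0 (sqrt 2) 0 0 0 (sqrt 2),
    m33 0 (sqrt 2) 0 (sqrt 2) 0 0 0 0 0,
    m33 0 0 (sqrt 2) 0 0 0 (sqrt 2) 0 0,
    m33 0 0 0 0 0 (sqrt 2) 0 (sqrt 2) 0,
    m33 0 0 0 0 (sqrt 2) 0 0 0 (- sqrt 2)]"

lemma gM_orthonormal_sym_basis: "gM_orthonormal (mat 1) (take n sym_basis)"
proof -
  have "gM_orthonormal (mat 1) sym_basis"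
    unfolding gM_orthonormal_def sym_basis_def
    by (simp add: gM_mat_1 mat3_simps All_less_Suc numeral_eq_Suc)
  then show ?thesis by (auto simp: gM_orthonormal_def)
qed

lemma sym_basis_expansion:
  assumes "v \<in> Sym"
  shows "v = (v $ 1 $ 1 / 2) *\<^sub>R sym_basis ! 0 + ((v $ 2 $ 2 + v $ 3 $ 3) / (2 * sqrt 2)) *\<^sub>R sym_basis ! 1
    + (v $ 1 $ 2 / sqrt 2) *\<^sub>R sym_basis ! 2 + (v $ 1 $ 3 / sqrt 2) *\<^sub>R sym_basis ! 3
    + (v $ 2 $ 3 / sqrt 2) *\<^sub>R sym_basis ! 4 + ((v $ 2 $ 2 - v $ 3 $ 3) / (2 * sqrt 2)) *\<^sub>R sym_basis ! 5"
  using assms by (simp add: mat3_eq_iff sym_basis_def Sym_iff field_simps)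

lemma span_sym_basis:
  "span (set (take 6 sym_basis)) = Sym"
  "span (set (take 5 sym_basis)) = {v \<in> Sym. v $ 2 $ 2 = v $ 3 $ 3}"
  "span (set (take 4 sym_basis)) = {v \<in> Sym. v $ 2 $ 2 = v $ 3 $ 3 \<and> v $ 2 $ 3 = 0}"
proof -
  have mem: "c *\<^sub>R sym_basis ! i \<in> span (set (take n sym_basis))" if "i < n" "i < 6" for i n c
  proof (intro span_scale span_base)
    have "i < length sym_basis" using that by (simp add: sym_basis_def)
    then show "sym_basis ! i \<in> set (take n sym_basis)" using that by (auto simp: in_set_conv_nth)
  qed
  have sub: "subspace {v \<in> Sym. v $ 2 $ 2 = v $ 3 $ 3}"
    "subspace {v \<in> Sym. v $ 2 $ 2 = v $ 3 $ 3 \<and> v $ 2 $ 3 = 0}"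
    using subspace_Sym by (auto simp: subspace_def)
  show "span (set (take 6 sym_basis)) = Sym"
  proof
    show "span (set (take 6 sym_basis)) \<subseteq> Sym"
      by (rule span_minimal[OF _ subspace_Sym]) (auto simp: sym_basis_def Sym_iff forall_3)
    show "Sym \<subseteq> span (set (take 6 sym_basis))"
      by (rule subsetI, subst sym_basis_expansion, assumption) (intro span_add mem; simp)
  qed
  show "span (set (take 5 sym_basis)) = {v \<in> Sym. v $ 2 $ 2 = v $ 3 $ 3}"
  proof
    show "span (set (take 5 sym_basis)) \<subseteq> {v \<in> Sym. v $ 2 $ 2 = v $ 3 $ 3}"
      by (rule span_minimal[OF _ sub(1)]) (auto simp: sym_basis_def Sym_iff forall_3)
    show "{v \<in> Sym. v $ 2 $ 2 = v $ 3 $ 3} \<subseteq> span (set (take 5 sym_basis))"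
    proof
      fix v :: mat3 assume v: "v \<in> {v \<in> Sym. v $ 2 $ 2 = v $ 3 $ 3}"
      then have "v \<in> Sym" by simp
      from sym_basis_expansion[OF this] v
      have "v = (v $ 1 $ 1 / 2) *\<^sub>R sym_basis ! 0 + ((v $ 2 $ 2 + v $ 3 $ 3) / (2 * sqrt 2)) *\<^sub>R sym_basis ! 1
        + (v $ 1 $ 2 / sqrt 2) *\<^sub>R sym_basis ! 2 + (v $ 1 $ 3 / sqrt 2) *\<^sub>R sym_basis ! 3
        + (v $ 2 $ 3 / sqrt 2) *\<^sub>R sym_basis ! 4" by simp
      also have "\<dots> \<in> span (set (take 5 sym_basis))" by (intro span_add mem; simp)
      finally show "v \<in> span (set (take 5 sym_basis))" .
    qed
  qed
  show "span (set (take 4 sym_basis)) = {v \<in> Sym. v $ 2 $ 2 = v $ 3 $ 3 \<and> v $ 2 $ 3 = 0}"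
  proof
    show "span (set (take 4 sym_basis)) \<subseteq> {v \<in> Sym. v $ 2 $ 2 = v $ 3 $ 3 \<and> v $ 2 $ 3 = 0}"
      by (rule span_minimal[OF _ sub(2)]) (auto simp: sym_basis_def Sym_iff forall_3)
    show "{v \<in> Sym. v $ 2 $ 2 = v $ 3 $ 3 \<and> v $ 2 $ 3 = 0} \<subseteq> span (set (take 4 sym_basis))"
    proof
      fix v :: mat3 assume v: "v \<in> {v \<in> Sym. v $ 2 $ 2 = v $ 3 $ 3 \<and> v $ 2 $ 3 = 0}"
      then have "v \<in> Sym" by simp
      from sym_basis_expansion[OF this] v
      have "v = (v $ 1 $ 1 / 2) *\<^sub>R sym_basis ! 0 + ((v $ 2 $ 2 + v $ 3 $ 3) / (2 * sqrt 2)) *\<^sub>R sym_basis ! 1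
        + (v $ 1 $ 2 / sqrt 2) *\<^sub>R sym_basis ! 2 + (v $ 1 $ 3 / sqrt 2) *\<^sub>R sym_basis ! 3" by simp
      also have "\<dots> \<in> span (set (take 4 sym_basis))" by (intro span_add mem; simp)
      finally show "v \<in> span (set (take 4 sym_basis))" .
    qed
  qed
qed

text \<open>Since accelerations are tangent, only the sum of the squares of the basis members
  remains. For \<open>n\<close> equal to 4 or 5 the third and fourth squares are not tangent
  separately, but their contributions balance in the sum.\<close>

lemma minimal_at_mat_1I:
  assumes "n \<in> {4, 5, 6}" "tspace S (mat 1) = span (set (take n sym_basis))"
    "\<And>v a. curve2 S (mat 1) v a \<Longrightarrow> a \<in> tspace S (mat 1)"
  shows "minimal_at S (mat 1)"
proof -
  let ?es = "take n sym_basis" and ?T = "tspace S (mat 1)"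
  have sub: "subspace ?T" unfolding assms(2) by (rule subspace_span)
  have "\<exists>a. curve2 S (mat 1) (?es ! i) a" if "i < length ?es" for i
  proof -
    have "?es ! i \<in> ?T" unfolding assms(2) using that by (intro span_base nth_mem)
    then show ?thesis by (simp add: tspace_def)
  qed
  then obtain F where F: "\<And>i. i < length ?es \<Longrightarrow> curve2 S (mat 1) (?es ! i) (F i)" by metis
  have "(\<Sum>i<length ?es. ?es ! i ** ?es ! i) \<in> ?T"
    using assms(1) unfolding assms(2)
    by (auto simp: span_sym_basis) (auto simp: sym_basis_def Sym_iff forall_3 mat3_mult_nth numeral_eq_Suc)
  moreover have "(\<Sum>i<length ?es. F i) \<in> ?T"
    using F assms(3) by (intro subspace_sum[OF sub]) auto
  ultimately have "(\<Sum>i<length ?es. F i - ?es ! i ** ?es ! i) \<in> ?T"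
    unfolding sum_subtractf by (rule subspace_diff[OF sub, rotated])
  then show ?thesis
    unfolding minimal_at_def using F assms(2) gM_orthonormal_sym_basis
    by (intro exI[of _ ?es] exI[of _ "map F [0..<length ?es]"]) (auto simp: matrix_inv_mat_1)
qed

lemma minimal_at_PosDef: "minimal_at PosDef (mat 1)"
proof (rule minimal_at_mat_1I[of 6])
  have S: "PosDef \<subseteq> Sym" using PosDef_Sym by blast
  show T: "tspace PosDef (mat 1) = span (set (take 6 sym_basis))"
    unfolding span_sym_basis
  proof
    show "Sym \<subseteq> tspace PosDef (mat 1)"
    proof
      fix v assume v: "v \<in> Sym"
      have "(1 / 2) *\<^sub>R v + transpose ((1 / 2) *\<^sub>R v) \<in> tspace PosDef (mat 1)"
        by (intro tspace_gram_curve pull_PosDef mat_1_PosDef)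
      moreover have "(1 / 2) *\<^sub>R v + transpose ((1 / 2) *\<^sub>R v) = v"
        using v by (simp add: Sym_def transpose_scalar scaleR_add_left[symmetric])
      ultimately show "v \<in> tspace PosDef (mat 1)" by simp
    qed
  qed (rule tspace_Sym[OF S])
  show "curve2 PosDef (mat 1) v a \<Longrightarrow> a \<in> tspace PosDef (mat 1)" for v a
    unfolding T span_sym_basis using curve2_Sym[OF S] by blast
qed simp

section \<open>Minimality of the model orbits\<close>

text \<open>The four equations say \<open>B A = s A B\<close> for the lower block \<open>B\<close>;
  the entries \<open>x\<close> and \<open>y\<close> are unconstrained because the ideal is
  abelian.\<close>

lemma lie_aut_semidirectI:
  assumes "invertible (m33 s 0 0 x p q y r w)"
    "p * t + q * b = s * (t * p + a * r)" "p * a + q * t = s * (t * q + a * w)"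
    "r * t + w * b = s * (b * p + t * r)" "r * a + w * t = s * (b * q + t * w)"
  shows "m33 s 0 0 x p q y r w \<in> lie_aut (semidirect t a b)"
proof -
  have "m33 s 0 0 x p q y r w *v semidirect t a b u v
      = semidirect t a b (m33 s 0 0 x p q y r w *v u) (m33 s 0 0 x p q y r w *v v)" for u v
    unfolding vec3_eq_iff using assms(2-)
    by (simp add: mat3_vec_nth) algebra
  then show ?thesis using assms(1) by (simp add: lie_aut_def)
qed

text \<open>The hypothesis \<open>nd\<close> says that \<open>A\<close> is not nilpotent. Then the
  ideal is preserved, and \<open>B A = s A B\<close> with \<open>B\<close> invertible forces
  \<open>s\<^sup>2 = 1\<close>, and \<open>s = 1\<close> if \<open>t\<close> is nonzero. The
  conclusion is the same relation for the traceless part of \<open>A\<close>.\<close>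

lemma lie_aut_semidirect_imp:
  assumes f: "f \<in> lie_aut (semidirect t a b)" and nd: "t \<noteq> 0 \<or> a * b \<noteq> 0"
  obtains s x p q y r w where "f = m33 s 0 0 x p q y r w" "p * w - q * r \<noteq> 0" "s\<^sup>2 = 1"
    "q * b = s * a * r" "p * a = s * a * w" "w * b = s * b * p" "r * a = s * b * q"
proof -
  have inv: "invertible f" and hom: "\<And>u v. f *v semidirect t a b u v = semidirect t a b (f *v u) (f *v v)"
    using f by (auto simp: lie_aut_def)
  note h = hom[of "axis 1 1" "axis 2 1"] hom[of "axis 1 1" "axis 3 1"] hom[of "axis 2 1" "axis 3 1"]
  have row1: "f $ 1 $ 2 * t + f $ 1 $ 3 * b = 0" "f $ 1 $ 2 * a + f $ 1 $ 3 * t = 0"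
    using h by (simp_all add: vec3_eq_iff mat3_vec_nth axis_def)
  have z: "f $ 1 $ 2 = 0 \<and> f $ 1 $ 3 = 0"
  proof (cases "t = 0")
    case True
    then show ?thesis using nd row1 by simp
  next
    case False
    \<comment> \<open>If \<open>f\<close> did not preserve the ideal, then \<open>k\<close> would be an eigenvector of \<open>A\<close> for the value \<open>2 t\<close>
      that \<open>f\<close> maps into the kernel of \<open>A\<close>.\<close>
    define k :: vec3 where "k = vector [0, f $ 1 $ 3, - f $ 1 $ 2]"
    have k: "k $ 1 = 0" "k $ 2 = f $ 1 $ 3" "k $ 3 = - f $ 1 $ 2" by (simp_all add: k_def vector_3)
    have "semidirect t a b (axis 1 1) k = (2 * t) *\<^sub>R k"
      using row1 by (simp add: vec3_eq_iff k axis_def algebra_simps)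
    then have "(2 * t) *\<^sub>R (f *v k) = semidirect t a b (f *v axis 1 1) (f *v k)"
      using hom[of "axis 1 1" k] by (simp add: matrix_vector_mult_scaleR)
    also have "\<dots> = 0"
    proof -
      have "(f *v k) $ 1 = 0" by (simp add: mat3_vec_nth k)
      moreover have "t * (f *v k) $ 2 + a * (f *v k) $ 3 = 0" "b * (f *v k) $ 2 + t * (f *v k) $ 3 = 0"
        using h(3) by (simp_all add: vec3_eq_iff mat3_vec_nth axis_def k algebra_simps)
      ultimately show ?thesis
        unfolding vec3_eq_iff semidirect_nth zero_index by algebra
    qed
    finally have "k = 0" using False invertible_eq_0_iff[OF inv] by simp
    then show ?thesis using k by simp
  qed
  define s x p q y r w where "s = f $ 1 $ 1" "x = f $ 2 $ 1" "p = f $ 2 $ 2" "q = f $ 2 $ 3"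
    "y = f $ 3 $ 1" "r = f $ 3 $ 2" "w = f $ 3 $ 3"
  note d = this
  have f_eq: "f = m33 s 0 0 x p q y r w" using z by (simp add: mat3_eq_iff d)
  have E: "p * t + q * b = s * (t * p + a * r)" "r * t + w * b = s * (b * p + t * r)"
     "p * a + q * t = s * (t * q + a * w)" "r * a + w * t = s * (b * q + t * w)"
    using h(1,2) by (simp_all add: f_eq vec3_eq_iff mat3_vec_nth axis_def algebra_simps)
  have "det f \<noteq> 0" using inv by (simp add: invertible_det_nz)
  then have D: "p * w - q * r \<noteq> 0" by (simp add: f_eq det_3 algebra_simps)
  \<comment> \<open>The trace of \<open>B A - s A B\<close> multiplied by the adjugate of
    \<open>B\<close>.\<close>
  have "2 * t * (1 - s) * (p * w - q * r) = 0" using E by algebra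
  then have ts: "t * (1 - s) = 0" using D by simp
  \<comment> \<open>The determinants of both sides of \<open>B A = s A B\<close>.\<close>
  have "(t\<^sup>2 - a * b) * (1 - s\<^sup>2) * (p * w - q * r) = 0" using E by algebra
  then have s2: "(t\<^sup>2 - a * b) * (1 - s\<^sup>2) = 0" using D by simp
  show thesis
  proof (rule that[OF f_eq D])
    show "s\<^sup>2 = 1" using nd ts s2 by (cases "t = 0") auto
    show "q * b = s * a * r" "p * a = s * a * w" "w * b = s * b * p" "r * a = s * b * q"
      using E ts by algebra+
  qed
qed

text \<open>Up to constants, this is the invariance of the squared norm of the traceless part of \<open>A\<close> with
  respect to the inner product that \<open>Q\<close> induces on the ideal.\<close>

lemma metric_class_semidirect_invariant:
  assumes Q: "Q \<in> metric_class (semidirect t a b) (mat 1)" and nd: "t \<noteq> 0 \<or> a * b \<noteq> 0"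
  shows "(b * Q $ 3 $ 3 - a * Q $ 2 $ 2)\<^sup>2 = (b - a)\<^sup>2 * (Q $ 2 $ 2 * Q $ 3 $ 3 - (Q $ 2 $ 3)\<^sup>2)"
proof -
  obtain k f where kf: "f \<in> lie_aut (semidirect t a b)" "Q = k *\<^sub>R pull f (mat 1)"
    using Q unfolding metric_class_eq[OF mat_1_PosDef] by blast
  obtain s x p q y r w where f: "f = m33 s 0 0 x p q y r w" and s: "s\<^sup>2 = 1"
    and e: "q * b = s * a * r" "p * a = s * a * w" "w * b = s * b * p" "r * a = s * b * q"
    using lie_aut_semidirect_imp[OF kf(1) nd] by metis
  have Q2: "Q $ 2 $ 2 = k * (p\<^sup>2 + r\<^sup>2)" "Q $ 3 $ 3 = k * (q\<^sup>2 + w\<^sup>2)" "Q $ 2 $ 3 = k * (p * q + r * w)"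
    by (simp_all add: kf(2) f pull_def mat3_simps power2_eq_square)
  have "b * Q $ 3 $ 3 - a * Q $ 2 $ 2 = k * s * (b - a) * (p * w - q * r)"
    unfolding Q2 using e by algebra
  moreover have "Q $ 2 $ 2 * Q $ 3 $ 3 - (Q $ 2 $ 3)\<^sup>2 = k\<^sup>2 * (p * w - q * r)\<^sup>2"
    unfolding Q2 by (simp add: power2_eq_square algebra_simps)
  ultimately show ?thesis using s by (simp add: power_mult_distrib)
qed

text \<open>The first two derivatives at 0 of the quadratic invariant along the curve. The first
  confines the velocity to a hyperplane; the second measures how far the acceleration leaves it.
  Both \<open>b - a\<close> and \<open>b + a\<close> are cancelled, which uses
  \<open>ab\<close>.\<close>

lemma semidirect_invariant_curve:
  assumes c: "curve2 S (mat 1) v d"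
    and S: "\<And>Q. Q \<in> S \<Longrightarrow> (b * Q $ 3 $ 3 - a * Q $ 2 $ 2)\<^sup>2 = (b - a)\<^sup>2 * (Q $ 2 $ 2 * Q $ 3 $ 3 - (Q $ 2 $ 3)\<^sup>2)"
    and ab: "a\<^sup>2 \<noteq> b\<^sup>2"
  shows "v $ 3 $ 3 = v $ 2 $ 2" "(b + a) * (d $ 3 $ 3 - d $ 2 $ 2) = - 2 * (b - a) * (v $ 2 $ 3)\<^sup>2"
proof -
  from c obtain \<gamma> \<gamma>' where g: "\<And>t. \<gamma> t \<in> S" "\<gamma> 0 = mat 1" "\<And>t. (\<gamma> has_vector_derivative \<gamma>' t) (at t)"
    "\<gamma>' 0 = v" "(\<gamma>' has_vector_derivative d) (at 0)"
    unfolding curve2_def by blast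
  have comp: "((\<lambda>t. F t $ i $ j) has_real_derivative D $ i $ j) (at t)"
    if "(F has_vector_derivative D) (at t)" for F :: "real \<Rightarrow> mat3" and D t i j
  proof -
    have "linear (\<lambda>A :: mat3. A $ i $ j)" by (rule linearI) simp_all
    then have "bounded_linear (\<lambda>A :: mat3. A $ i $ j)" by (simp add: linear_conv_bounded_linear)
    from bounded_linear.has_vector_derivative[OF this that] show ?thesis
      by (simp add: has_real_derivative_iff_has_vector_derivative)
  qed
  define u z w where "u = (\<lambda>t. \<gamma> t $ 2 $ 2)" "z = (\<lambda>t. \<gamma> t $ 3 $ 3)" "w = (\<lambda>t. \<gamma> t $ 2 $ 3)"
  define u' z' w' where "u' = (\<lambda>t. \<gamma>' t $ 2 $ 2)" "z' = (\<lambda>t. \<gamma>' t $ 3 $ 3)" "w' = (\<lambda>t. \<gamma>' t $ 2 $ 3)"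
  note defs = \<open>u = _\<close> \<open>z = _\<close> \<open>w = _\<close> \<open>u' = _\<close> \<open>z' = _\<close> \<open>w' = _\<close>
  have D1: "(u has_real_derivative u' t) (at t)" "(z has_real_derivative z' t) (at t)"
    "(w has_real_derivative w' t) (at t)" for t
    unfolding defs by (intro comp g)+
  have D2: "(u' has_real_derivative d $ 2 $ 2) (at 0)" "(z' has_real_derivative d $ 3 $ 3) (at 0)"
    "(w' has_real_derivative d $ 2 $ 3) (at 0)"
    unfolding defs by (intro comp g)+
  have G0: "(b * z t - a * u t)\<^sup>2 - (b - a)\<^sup>2 * (u t * z t - (w t)\<^sup>2) = 0" for t
    using S[OF g(1)[of t]] by (simp add: defs)
  define G1 where "G1 = (\<lambda>t. 2 * (b * z t - a * u t) * (b * z' t - a * u' t)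
      - (b - a)\<^sup>2 * (u' t * z t + u t * z' t - 2 * w t * w' t))"
  have "((\<lambda>t. (b * z t - a * u t)\<^sup>2 - (b - a)\<^sup>2 * (u t * z t - (w t)\<^sup>2)) has_real_derivative G1 t) (at t)" for t
    unfolding G1_def by (auto intro!: derivative_eq_intros D1 simp: algebra_simps)
  then have "((\<lambda>t. 0) has_real_derivative G1 t) (at t)" for t by (simp add: G0)
  then have G1: "G1 t = 0" for t using DERIV_unique DERIV_const by blast
  have at0: "u 0 = 1" "z 0 = 1" "w 0 = 0" "u' 0 = v $ 2 $ 2" "z' 0 = v $ 3 $ 3" "w' 0 = v $ 2 $ 3"
    by (simp_all add: defs g)
  have "(b - a) * (b + a) = b\<^sup>2 - a\<^sup>2" by (simp add: power2_eq_square algebra_simps)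
  then have ba: "b - a \<noteq> 0" "b + a \<noteq> 0" using ab by auto
  have "(b - a) * ((b + a) * (v $ 3 $ 3 - v $ 2 $ 2)) = G1 0"
    by (simp add: G1_def at0 power2_eq_square algebra_simps)
  then show vv: "v $ 3 $ 3 = v $ 2 $ 2" using G1 ba by simp
  have "(G1 has_real_derivative 2 * (b * z' 0 - a * u' 0) * (b * z' 0 - a * u' 0)
      + 2 * (b * z 0 - a * u 0) * (b * d $ 3 $ 3 - a * d $ 2 $ 2)
      - (b - a)\<^sup>2 * (d $ 2 $ 2 * z 0 + u' 0 * z' 0 + (u' 0 * z' 0 + u 0 * d $ 3 $ 3)
        - (2 * w' 0 * w' 0 + 2 * w 0 * d $ 2 $ 3))) (at 0)"
    unfolding G1_def by (rule derivative_eq_intros D1 D2 refl)+ (simp add: algebra_simps)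
  then have "2 * (b * z' 0 - a * u' 0) * (b * z' 0 - a * u' 0)
      + 2 * (b * z 0 - a * u 0) * (b * d $ 3 $ 3 - a * d $ 2 $ 2)
      - (b - a)\<^sup>2 * (d $ 2 $ 2 * z 0 + u' 0 * z' 0 + (u' 0 * z' 0 + u 0 * d $ 3 $ 3)
        - (2 * w' 0 * w' 0 + 2 * w 0 * d $ 2 $ 3)) = 0"
    using DERIV_unique DERIV_const G1 by (metis (no_types, lifting) ext)
  then have "(b - a) * ((b + a) * (d $ 3 $ 3 - d $ 2 $ 2) + 2 * (b - a) * (v $ 2 $ 3)\<^sup>2) = 0"
    unfolding at0 vv by (simp add: power2_eq_square algebra_simps)
  then have "(b + a) * (d $ 3 $ 3 - d $ 2 $ 2) + 2 * (b - a) * (v $ 2 $ 3)\<^sup>2 = 0"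
    using ba(1) by (metis mult_eq_0_iff)
  then show "(b + a) * (d $ 3 $ 3 - d $ 2 $ 2) = - 2 * (b - a) * (v $ 2 $ 3)\<^sup>2" by linarith
qed

text \<open>The lower block of \<open>X\<close> is a scalar matrix plus \<open>r\<close> times the
  traceless part of \<open>A\<close>, so the lower block of every combination of \<open>X\<close>
  with the identity commutes with \<open>A\<close>. The entry \<open>r * (a + b)\<close> arises from
  symmetrizing.\<close>

lemma tspace_semidirectI:
  assumes "v \<in> Sym" "v $ 2 $ 2 = v $ 3 $ 3" "v $ 2 $ 3 = r * (a + b)"
  shows "v \<in> tspace (metric_class (semidirect t a b) (mat 1)) (mat 1)"
proof -
  define X where "X = m33 (v $ 1 $ 1 / 2) 0 0 (v $ 1 $ 2) (v $ 2 $ 2 / 2) (r * a) (v $ 1 $ 3) (r * b) (v $ 2 $ 2 / 2)"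
  have "X + transpose X \<in> tspace (metric_class (semidirect t a b) (mat 1)) (mat 1)"
  proof (rule tspace_gram_curve)
    fix p q assume inv: "invertible (p *\<^sub>R mat 1 + q *\<^sub>R X)"
    define s where "s = p + q * (v $ 1 $ 1 / 2)"
    define h where "h = p + q * (v $ 2 $ 2 / 2)"
    have M: "p *\<^sub>R mat 1 + q *\<^sub>R X = m33 s 0 0 (q * v $ 1 $ 2) h (q * r * a) (q * v $ 1 $ 3) (q * r * b) h"
      by (simp add: mat3_eq_iff X_def s_def h_def)
    have "det (p *\<^sub>R mat 1 + q *\<^sub>R X) \<noteq> 0" using inv by (simp add: invertible_det_nz)
    then have s: "s \<noteq> 0" unfolding M by (auto simp: det_3)
    \<comment> \<open>Dividing by the corner entry makes it 1, so commuting with \<open>A\<close> is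
      all that an automorphism requires.\<close>
    define f where "f = m33 1 0 0 (q * v $ 1 $ 2 / s) (h / s) (q * r * a / s) (q * v $ 1 $ 3 / s) (q * r * b / s) (h / s)"
    have Mf: "p *\<^sub>R mat 1 + q *\<^sub>R X = s *\<^sub>R f" unfolding M using s by (simp add: mat3_eq_iff f_def)
    have "invertible f"
      using inv scalar_invertible[of "1 / s" "s *\<^sub>R f"] s unfolding Mf by simp
    then have "f \<in> lie_aut (semidirect t a b)"
      unfolding f_def by (rule lie_aut_semidirectI) (simp_all add: field_simps)
    moreover have "pull (s *\<^sub>R f) (mat 1) = s\<^sup>2 *\<^sub>R pull f (mat 1)"
      by (simp add: pull_def transpose_scalar matrix_mult_simps power2_eq_square)
    moreover have "s\<^sup>2 > 0" using s by simp
    ultimately show "pull (p *\<^sub>R mat 1 + q *\<^sub>R X) (mat 1) \<in> metric_class (semidirect t a b) (mat 1)"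
      unfolding Mf metric_class_eq[OF mat_1_PosDef] by blast
  qed
  moreover have "X + transpose X = v"
    using assms by (simp add: mat3_eq_iff X_def transpose_nth Sym_iff algebra_simps)
  ultimately show ?thesis by simp
qed

text \<open>For scalar or strictly lower triangular \<open>A\<close>, every invertible lower
  triangular matrix with positive diagonal is a multiple of an automorphism, so the triangular
  factorization reaches all of \<open>PosDef\<close>.\<close>

lemma metric_class_semidirect_full:
  assumes "a = 0" "b = 0 \<or> t = 0"
  shows "metric_class (semidirect t a b) (mat 1) = PosDef"
proof
  show "PosDef \<subseteq> metric_class (semidirect t a b) (mat 1)"
  proof
    fix Q assume "Q \<in> PosDef"
    then obtain l1 l2 l3 l4 l5 l6 where l: "l1 > 0" "l3 > 0" "l6 > 0"
      and Q: "Q = transpose (m33 l1 0 0 l2 l3 0 l4 l5 l6) ** m33 l1 0 0 l2 l3 0 l4 l5 l6"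
      and inv: "invertible (m33 l1 0 0 l2 l3 0 l4 l5 l6)"
      using PosDef_cholesky by metis
    \<comment> \<open>For scalar \<open>A\<close> the corner entry of the automorphism is made 1; in
      the nilpotent case its diagonal must satisfy \<open>w = s * p\<close>, which determines
      \<open>c\<close>.\<close>
    define c where "c = (if b = 0 then l1 else l1 * l3 / l6)"
    have c: "c > 0" using l by (simp add: c_def)
    let ?f = "m33 (l1 / c) 0 0 (l2 / c) (l3 / c) 0 (l4 / c) (l5 / c) (l6 / c)"
    have L: "m33 l1 0 0 l2 l3 0 l4 l5 l6 = c *\<^sub>R ?f" using c by (simp add: mat3_eq_iff)
    have "invertible ?f"
      using inv scalar_invertible[of "1 / c" "c *\<^sub>R ?f"] c unfolding L by simp
    then have "?f \<in> lie_aut (semidirect t a b)"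
      using assms c l by (intro lie_aut_semidirectI) (auto simp: c_def field_simps)
    moreover have "Q = c\<^sup>2 *\<^sub>R pull ?f (mat 1)"
      unfolding Q L by (simp add: pull_def transpose_scalar matrix_mult_simps power2_eq_square)
    moreover have "c\<^sup>2 > 0" using c by simp
    ultimately show "Q \<in> metric_class (semidirect t a b) (mat 1)"
      unfolding metric_class_eq[OF mat_1_PosDef] by blast
  qed
qed (rule metric_class_subset_PosDef)

text \<open>The quadratic invariant degenerates to linear equations:
  \<open>Q\<^sub>2\<^sub>2 = Q\<^sub>3\<^sub>3\<close> if \<open>a = b\<close> (a geodesic in the
  hyperbolic plane), and also \<open>Q\<^sub>2\<^sub>3 = 0\<close> if \<open>a = - b\<close> (a
  fixed point). Accelerations obey them as well and are therefore tangent.\<close>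

lemma minimal_semidirect_normal:
  assumes "a\<^sup>2 = b\<^sup>2" "a \<noteq> 0"
  shows "minimal_at (metric_class (semidirect t a b) (mat 1)) (mat 1)" (is "minimal_at ?S _")
proof -
  have S: "?S \<subseteq> Sym" using metric_class_subset_PosDef PosDef_Sym by blast
  have nd: "t \<noteq> 0 \<or> a * b \<noteq> 0" using assms by auto
  consider "a = b" | "a = - b" using assms(1) by (auto simp: power2_eq_iff)
  then show ?thesis
  proof cases
    case 1
    have l: "linear (\<lambda>A :: mat3. A $ 2 $ 2 - A $ 3 $ 3)" by (rule linearI) (simp_all add: algebra_simps)
    have 0: "Q $ 2 $ 2 - Q $ 3 $ 3 = 0" if "Q \<in> ?S" for Q
    proof -
      have "b * (Q $ 3 $ 3 - Q $ 2 $ 2) = 0"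
        using metric_class_semidirect_invariant[OF that nd] 1 by (simp add: right_diff_distrib)
      then show ?thesis using assms 1 by simp
    qed
    have T: "tspace ?S (mat 1) = {v \<in> Sym. v $ 2 $ 2 = v $ 3 $ 3}"
    proof
      show "tspace ?S (mat 1) \<subseteq> {v \<in> Sym. v $ 2 $ 2 = v $ 3 $ 3}"
        using curve2_linear_0(1)[OF l 0] curve2_Sym(1)[OF S] by (auto simp: tspace_def)
      show "{v \<in> Sym. v $ 2 $ 2 = v $ 3 $ 3} \<subseteq> tspace ?S (mat 1)"
        using tspace_semidirectI[of _ "_ $ 2 $ 3 / (a + b)" a b t] 1 assms(2) by fastforce
    qed
    show ?thesis
      by (rule minimal_at_mat_1I[of 5])
        (use T span_sym_basis curve2_linear_0(2)[OF l 0] curve2_Sym(2)[OF S] in auto)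
  next
    case 2
    have l: "linear (\<lambda>A :: mat3. A $ 2 $ 2 - A $ 3 $ 3)" "linear (\<lambda>A :: mat3. A $ 2 $ 3)"
      by (rule linearI; simp add: algebra_simps)+
    have "Q $ 2 $ 2 = Q $ 3 $ 3 \<and> Q $ 2 $ 3 = 0" if "Q \<in> ?S" for Q
    proof -
      \<comment> \<open>For \<open>a = - b\<close> the invariant becomes a sum of two
        squares.\<close>
      have "b\<^sup>2 * ((Q $ 2 $ 2 - Q $ 3 $ 3)\<^sup>2 + (2 * Q $ 2 $ 3)\<^sup>2) = 0"
        using metric_class_semidirect_invariant[OF that nd] 2 by (simp add: power2_eq_square algebra_simps)
      moreover have "b\<^sup>2 \<noteq> 0" using assms 2 by simp
      ultimately have "(Q $ 2 $ 2 - Q $ 3 $ 3)\<^sup>2 + (2 * Q $ 2 $ 3)\<^sup>2 = 0" by (metis mult_eq_0_iff)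
      then show ?thesis unfolding sum_power2_eq_zero_iff by simp
    qed
    then have 0: "Q $ 2 $ 2 - Q $ 3 $ 3 = 0" "Q $ 2 $ 3 = 0" if "Q \<in> ?S" for Q using that by simp_all
    have T: "tspace ?S (mat 1) = {v \<in> Sym. v $ 2 $ 2 = v $ 3 $ 3 \<and> v $ 2 $ 3 = 0}"
    proof
      show "tspace ?S (mat 1) \<subseteq> {v \<in> Sym. v $ 2 $ 2 = v $ 3 $ 3 \<and> v $ 2 $ 3 = 0}"
        using curve2_linear_0(1)[OF l(1) 0(1)] curve2_linear_0(1)[OF l(2) 0(2)] curve2_Sym(1)[OF S]
        by (auto simp: tspace_def)
      show "{v \<in> Sym. v $ 2 $ 2 = v $ 3 $ 3 \<and> v $ 2 $ 3 = 0} \<subseteq> tspace ?S (mat 1)"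
        using tspace_semidirectI[of _ 0 a b t] by auto
    qed
    show ?thesis
      by (rule minimal_at_mat_1I[of 4])
        (use T span_sym_basis curve2_linear_0(2)[OF l(1) 0(1)] curve2_linear_0(2)[OF l(2) 0(2)]
          curve2_Sym(2)[OF S] in auto)
  qed
qed

text \<open>A tangent sum would have equal (2,2) and (3,3) entries. The squares of the basis members
  contribute equally to both entries, while the accelerations contribute a total difference
  proportional to \<open>b - a\<close>, which is nonzero.\<close>

lemma not_minimal_semidirect:
  assumes ab: "a\<^sup>2 \<noteq> b\<^sup>2" and nd: "t \<noteq> 0 \<or> a * b \<noteq> 0"
  shows "\<not> minimal_at (metric_class (semidirect t a b) (mat 1)) (mat 1)" (is "\<not> minimal_at ?S _")
proof
  assume "minimal_at ?S (mat 1)"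
  then obtain es as where len: "length as = length es" and o: "gM_orthonormal (mat 1) es"
    and sp: "span (set es) = tspace ?S (mat 1)"
    and c: "\<And>i. i < length es \<Longrightarrow> curve2 ?S (mat 1) (es ! i) (as ! i)"
    and H: "(\<Sum>i<length es. as ! i - es ! i ** es ! i) \<in> tspace ?S (mat 1)"
    unfolding minimal_at_def matrix_inv_mat_1 by auto
  have S: "?S \<subseteq> Sym" using metric_class_subset_PosDef PosDef_Sym by blast
  note ic = semidirect_invariant_curve[OF _ metric_class_semidirect_invariant[OF _ nd] ab]
  have T: "v \<in> Sym \<and> v $ 3 $ 3 = v $ 2 $ 2" if "v \<in> tspace ?S (mat 1)" for v
    using that ic(1) curve2_Sym(1)[OF S] unfolding tspace_def by blast
  have es: "set es \<subseteq> Sym" using T sp span_superset by blast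
  have e: "es ! i $ 2 $ 1 = es ! i $ 1 $ 2" "es ! i $ 3 $ 1 = es ! i $ 1 $ 3"
    "es ! i $ 3 $ 2 = es ! i $ 2 $ 3" "es ! i $ 3 $ 3 = es ! i $ 2 $ 2" if "i < length es" for i
    using es nth_mem[OF that] ic(1)[OF c[OF that]] by (auto simp: Sym_iff)
  have "(b - a) * (b + a) = b\<^sup>2 - a\<^sup>2" by (simp add: power2_eq_square algebra_simps)
  then have ba: "b + a \<noteq> 0" "b - a \<noteq> 0" using ab by auto
  have pars: "(\<Sum>i<length es. (gM (mat 1) u (es ! i))\<^sup>2) = gM (mat 1) u u" if "u \<in> tspace ?S (mat 1)" for u
    using gM_orthonormal_parseval[OF mat_1_PosDef o es, of u u] that sp by (simp add: power2_eq_square)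
  have "(\<Sum>i<length es. (es ! i $ 1 $ 2 / 2)\<^sup>2) = 1 / 2"
  proof -
    \<comment> \<open>This tangent vector has squared norm 1/2, and its product with
      \<open>es ! i\<close> is half of the (1,2) entry; the next two vectors treat the other
      off-diagonal entries alike.\<close>
    have "m33 0 1 0 1 0 0 0 0 0 \<in> tspace ?S (mat 1)"
      by (rule tspace_semidirectI[of _ 0]) (auto simp: Sym_iff forall_3)
    note pars[OF this]
    moreover have "(\<Sum>i<length es. (es ! i $ 1 $ 2 / 2)\<^sup>2) = (\<Sum>i<length es. (gM (mat 1) (m33 0 1 0 1 0 0 0 0 0) (es ! i))\<^sup>2)"
      by (intro sum.cong refl) (simp add: gM_mat_1 mat3_simps e)
    ultimately show ?thesis by (simp add: gM_mat_1 mat3_simps)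
  qed
  moreover have "(\<Sum>i<length es. (es ! i $ 1 $ 3 / 2)\<^sup>2) = 1 / 2"
  proof -
    have "m33 0 0 1 0 0 0 1 0 0 \<in> tspace ?S (mat 1)"
      by (rule tspace_semidirectI[of _ 0]) (auto simp: Sym_iff forall_3)
    note pars[OF this]
    moreover have "(\<Sum>i<length es. (es ! i $ 1 $ 3 / 2)\<^sup>2) = (\<Sum>i<length es. (gM (mat 1) (m33 0 0 1 0 0 0 1 0 0) (es ! i))\<^sup>2)"
      by (intro sum.cong refl) (simp add: gM_mat_1 mat3_simps e)
    ultimately show ?thesis by (simp add: gM_mat_1 mat3_simps)
  qed
  moreover have "(\<Sum>i<length es. (es ! i $ 2 $ 3 / 2)\<^sup>2) = 1 / 2"
  proof -
    have "m33 0 0 0 0 0 1 0 1 0 \<in> tspace ?S (mat 1)"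
      using ba by (intro tspace_semidirectI[of _ "1 / (a + b)"]) (auto simp: Sym_iff forall_3 add.commute)
    note pars[OF this]
    moreover have "(\<Sum>i<length es. (es ! i $ 2 $ 3 / 2)\<^sup>2) = (\<Sum>i<length es. (gM (mat 1) (m33 0 0 0 0 0 1 0 1 0) (es ! i))\<^sup>2)"
      by (intro sum.cong refl) (simp add: gM_mat_1 mat3_simps e)
    ultimately show ?thesis by (simp add: gM_mat_1 mat3_simps)
  qed
  \<comment> \<open>By Parseval, these sums do not depend on the choice of the orthonormal basis.\<close>
  ultimately have sums: "(\<Sum>i<length es. (es ! i $ 1 $ 2)\<^sup>2) = 2" "(\<Sum>i<length es. (es ! i $ 1 $ 3)\<^sup>2) = 2"
      "(\<Sum>i<length es. (es ! i $ 2 $ 3)\<^sup>2) = 2"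
    by (simp_all add: power_divide sum_divide_distrib[symmetric])
  let ?W = "\<Sum>i<length es. as ! i - es ! i ** es ! i"
  have "?W $ 3 $ 3 - ?W $ 2 $ 2 = (\<Sum>i<length es. (as ! i $ 3 $ 3 - as ! i $ 2 $ 2) + (es ! i $ 1 $ 2)\<^sup>2 - (es ! i $ 1 $ 3)\<^sup>2)"
    unfolding sum_component sum_subtractf[symmetric]
    by (intro sum.cong refl) (simp add: mat3_mult_nth e power2_eq_square)
  moreover have "?W $ 3 $ 3 - ?W $ 2 $ 2 = 0" using T[OF H] by simp
  ultimately have "(\<Sum>i<length es. as ! i $ 3 $ 3 - as ! i $ 2 $ 2) = 0"
    by (simp add: sum.distrib sum_subtractf sums)
  then have "0 = (\<Sum>i<length es. (b + a) * (as ! i $ 3 $ 3 - as ! i $ 2 $ 2))"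
    by (simp add: sum_distrib_left[symmetric])
  also have "\<dots> = (\<Sum>i<length es. - 2 * (b - a) * (es ! i $ 2 $ 3)\<^sup>2)"
    using ic(2)[OF c] by (intro sum.cong) auto
  also have "\<dots> = - 2 * (b - a) * 2" by (simp only: sum_distrib_left[symmetric] sums)
  finally show False using ba by simp
qed

lemma minimal_semidirect_iff:
  "minimal_submanifold (metric_class (semidirect t a b) (mat 1)) \<longleftrightarrow> a\<^sup>2 = b\<^sup>2 \<or> (t = 0 \<and> a * b = 0)"
proof -
  have full: "minimal_submanifold (metric_class (semidirect t a b) (mat 1))" if "a = 0" "b = 0 \<or> t = 0" for t a b
    using minimal_at_PosDef minimal_metric_class_iff[OF mat_1_PosDef] metric_class_semidirect_full[OF that] by metis
  \<comment> \<open>The triangular factorization treats lower triangular nilpotent \<open>A\<close>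
    only; exchanging \<open>e\<^sub>2\<close> and \<open>e\<^sub>3\<close> covers the upper
    triangular one.\<close>
  have swap: "minimal_submanifold (metric_class (semidirect 0 a 0) (mat 1))"
  proof -
    let ?g = "m33 1 0 0 0 0 1 0 1 0"
    have gg: "?g ** ?g = mat 1" by (simp add: mat3_eq_iff mat3_mult_nth)
    note g = matrix_inv_unique_left[OF gg]
    have "transport ?g (semidirect 0 0 a) = semidirect 0 a 0"
      by (intro ext) (simp add: transport_def g vec3_eq_iff mat3_vec_nth)
    moreover have "pull ?g (mat 1) = mat 1"
      by (simp add: pull_def mat3_eq_iff mat3_simps)
    ultimately show ?thesis
      using minimal_transport[OF g(2) mat_1_PosDef, of "semidirect 0 0 a"] full[of 0 a 0] by simp
  qed
  show ?thesis
  proof (cases "a\<^sup>2 = b\<^sup>2 \<or> (t = 0 \<and> a * b = 0)")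
    case True
    then consider "a = 0" "b = 0 \<or> t = 0" | "t = 0" "b = 0" | "a\<^sup>2 = b\<^sup>2" "a \<noteq> 0" by fastforce
    then have "minimal_submanifold (metric_class (semidirect t a b) (mat 1))"
    proof cases
      case 1 then show ?thesis by (rule full)
    next
      case 2 then show ?thesis using swap by simp
    next
      case 3 then show ?thesis
        using minimal_semidirect_normal minimal_metric_class_iff[OF mat_1_PosDef] by blast
    qed
    then show ?thesis using True by simp
  next
    case False
    then show ?thesis
      using not_minimal_semidirect[of a b t] minimal_metric_class_iff[OF mat_1_PosDef] by blast
  qed
qed

section \<open>Normal form\<close>

unbundle cross3_syntax

lemma transport_transport:
  "invertible g \<Longrightarrow> invertible h \<Longrightarrow> transport h (transport g br) = transport (g ** h) br"
  by (intro ext) (simp add: transport_def matrix_inv_mult matrix_vector_mul_assoc[symmetric])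

lemma lie_algebra_transport:
  assumes "lie_algebra br" "invertible g" shows "lie_algebra (transport g br)"
proof -
  have "matrix_inv g *v br x (br y z) + matrix_inv g *v br y (br z x) + matrix_inv g *v br z (br x y) = 0" for x y z
    using assms(1) unfolding lie_algebra_def
    by (metis matrix_vector_mult_0_right matrix_vector_right_distrib)
  then show ?thesis
    using assms bilinear_transport unfolding lie_algebra_def
    by (auto simp: transport_def matrix_inv_cancel)
qed

text \<open>If the brackets spanned everything, the derived series would be constant and never reach
  \<open>{0}\<close>. So they lie in a hyperplane, with normal vector \<open>n\<close>.\<close>

lemma solvable_derived_orthogonal:
  assumes "solvable_lie br"
  obtains n where "n \<noteq> 0" "\<And>x y. n \<bullet> br x y = 0"
proof -
  let ?D = "{br x y | x y. True}"
  have "span ?D \<noteq> UNIV"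
  proof
    assume U: "span ?D = UNIV"
    have D: "derived_series br k = UNIV" for k
    proof (induction k)
      case (Suc k)
      then show ?case using U by simp
    qed simp
    obtain k where "derived_series br k = {0}" using assms by (auto simp: solvable_lie_def)
    then have "axis 1 1 \<in> {0 :: vec3}" using D by blast
    then show False by (simp add: axis_eq_0_iff)
  qed
  then obtain n where n: "n \<noteq> 0" "span ?D \<subseteq> {x. n \<bullet> x = 0}"
    using span_not_univ_subset_hyperplane by blast
  have "n \<bullet> br x y = 0" for x y
  proof -
    have "br x y \<in> span ?D" by (rule span_base) blast
    then show ?thesis using n(2) by blast
  qed
  then show thesis using that n(1) by blast
qed

text \<open>An alternating bilinear map factors through the exterior square, identified here with
  three-space by the cross product. The columns of \<open>M\<close> are the brackets of the cyclic
  pairs of basis vectors.\<close>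

lemma bracket_eq_cross:
  assumes "lie_algebra br"
  obtains M :: mat3 where "\<And>x y. br x y = M *v (x \<times> y)"
proof -
  have bl: "bilinear br" and alt: "\<And>x. br x x = 0" using assms by (auto simp: lie_algebra_def)
  note bs = bilinear_ladd[OF bl] bilinear_radd[OF bl] bilinear_lmul[OF bl] bilinear_rmul[OF bl]
  have skew: "br x y = - br y x" for x y
    using alt[of "x + y"] alt[of x] alt[of y] by (simp add: bs eq_neg_iff_add_eq_0 add.commute)
  define c1 c2 c3 where "c1 = br (axis 2 1) (axis 3 1)" "c2 = br (axis 3 1) (axis 1 1)" "c3 = br (axis 1 1) (axis 2 1)"
  note c = this
  define M where "M = m33 (c1 $ 1) (c2 $ 1) (c3 $ 1) (c1 $ 2) (c2 $ 2) (c3 $ 2) (c1 $ 3) (c2 $ 3) (c3 $ 3)"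
  have ex: "x = x $ 1 *\<^sub>R axis 1 1 + x $ 2 *\<^sub>R axis 2 1 + x $ 3 *\<^sub>R axis 3 1" for x :: vec3
    by (simp add: vec3_eq_iff axis_def)
  have "br x y = M *v (x \<times> y)" for x y
  proof -
    have "br x y = (x $ 2 * y $ 3 - x $ 3 * y $ 2) *\<^sub>R c1 + (x $ 3 * y $ 1 - x $ 1 * y $ 3) *\<^sub>R c2
        + (x $ 1 * y $ 2 - x $ 2 * y $ 1) *\<^sub>R c3"
      by (subst ex[of x], subst ex[of y])
        (simp add: bs alt c skew[of "axis 3 1" "axis 2 1"] skew[of "axis 1 1" "axis 3 1"]
          skew[of "axis 2 1" "axis 1 1"] algebra_simps)
    then show ?thesis
      by (simp add: vec3_eq_iff mat3_vec_nth M_def cross3_def vector_3 algebra_simps)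
  qed
  then show thesis by (rule that)
qed

text \<open>The Jacobi identity says that \<open>M\<close> kills the axial vector of its skew part; if that vector vanishes,
  \<open>M\<close> is symmetric, and singular because the bracket is not perfect. The orthogonal complement of \<open>u\<close>
  is an abelian ideal.\<close>

lemma bracket_common_kernel:
  assumes "lie_algebra br" and M: "\<And>x y. br x y = M *v (x \<times> y)"
    and n: "n \<noteq> 0" "\<And>x y. n \<bullet> br x y = 0"
  obtains u where "norm u = 1" "M *v u = 0" "u v* M = 0"
proof -
  define w :: vec3 where "w = vector [M $ 3 $ 2 - M $ 2 $ 3, M $ 1 $ 3 - M $ 3 $ 1, M $ 2 $ 1 - M $ 1 $ 2]"
  have jac: "br (axis 1 1) (br (axis 2 1) (axis 3 1)) + br (axis 2 1) (br (axis 3 1) (axis 1 1))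
      + br (axis 3 1) (br (axis 1 1) (axis 2 1)) = 0"
    using assms(1) by (simp add: lie_algebra_def)
  then have Mw: "M *v w = 0"
    unfolding M by (simp add: vec3_eq_iff mat3_vec_nth w_def cross3_def vector_3 axis_def algebra_simps)
  have "\<exists>u. u \<noteq> 0 \<and> M *v u = 0 \<and> u v* M = 0"
  proof (cases "w = 0")
    case False
    \<comment> \<open>\<open>M - transpose M\<close> acts as the cross product with
      \<open>w\<close>, so it kills \<open>w\<close>.\<close>
    have "w v* M = M *v w"
      by (simp add: vec3_eq_iff mat3_vec_nth vector_matrix_mult_def sum_3 w_def vector_3 algebra_simps)
    then show ?thesis using Mw False by auto
  next
    case True
    then have "M $ 3 $ 2 = M $ 2 $ 3" "M $ 1 $ 3 = M $ 3 $ 1" "M $ 2 $ 1 = M $ 1 $ 2"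
      by (auto simp: w_def vec3_eq_iff vector_3)
    then have s: "n v* M = M *v n"
      by (simp add: vec3_eq_iff mat3_vec_nth vector_matrix_mult_def sum_3 algebra_simps)
    have "(n v* M) \<bullet> (x \<times> y) = 0" for x y using n(2)[of x y] by (simp add: M dot_lmul_matrix)
    from this[of "axis 2 1" "axis 3 1"] this[of "axis 3 1" "axis 1 1"] this[of "axis 1 1" "axis 2 1"]
    have "n v* M = 0"
      by (simp add: vec3_eq_iff inner_vec3 cross3_def vector_3 axis_def)
    then show ?thesis using s n(1) by auto
  qed
  then obtain u where u: "u \<noteq> 0" "M *v u = 0" "u v* M = 0" by blast
  show thesis
    by (rule that[of "(1 / norm u) *\<^sub>R u"])
      (use u in \<open>simp_all add: matrix_vector_mult_scaleR scaleR_vector_matrix_assoc\<close>)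
qed

text \<open>Rotations respect the cross product, so \<open>M\<close> transforms like a bilinear
  form.\<close>

lemma transport_rotation:
  assumes M: "\<And>x y. br x y = M *v (x \<times> y)" and R: "rotation_matrix R"
  shows "invertible R" "pull R (mat 1) = mat 1" "transport R br x y = pull R M *v (x \<times> y)"
proof -
  have o: "transpose R ** R = mat 1" using R by (simp add: rotation_matrix_def orthogonal_matrix)
  show "pull R (mat 1) = mat 1" using o by (simp add: pull_def)
  show "invertible R" using matrix_inv_unique_left[OF o] by simp
  have "matrix_inv R = transpose R" using matrix_inv_unique_left[OF o] by simp
  then show "transport R br x y = pull R M *v (x \<times> y)"
    by (simp add: transport_def M cross_rotation_matrix[OF R] pull_def matrix_vector_mul_assoc
        matrix_mul_assoc del: transpose_matrix_vector)
qed

text \<open>Choose an angle whose unit vector is orthogonal to \<open>(p, q)\<close> and halve it;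
  the double angle formulas do the rest. This is the rotation that diagonalizes a symmetric 2 by 2
  matrix.\<close>

lemma rotate_off_diagonal:
  obtains c s :: real where "c\<^sup>2 + s\<^sup>2 = 1" "p * (c\<^sup>2 - s\<^sup>2) + q * (2 * s * c) = 0"
proof -
  obtain \<theta> where \<theta>: "p * cos \<theta> + q * sin \<theta> = 0"
  proof (cases "p = 0 \<and> q = 0")
    case False
    define r where "r = sqrt (p\<^sup>2 + q\<^sup>2)"
    have r: "r\<^sup>2 = p\<^sup>2 + q\<^sup>2" "r \<noteq> 0" using False by (auto simp: r_def sum_power2_eq_zero_iff)
    have "(q / r)\<^sup>2 + (- p / r)\<^sup>2 = (p\<^sup>2 + q\<^sup>2) / r\<^sup>2"
      by (simp add: power_divide add_divide_distrib add.commute)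
    also have "\<dots> = 1" unfolding r(1)[symmetric] using r(2) by simp
    finally obtain \<theta> where "q / r = cos \<theta>" "- p / r = sin \<theta>" using sincos_total_2pi by metis
    then have "p * cos \<theta> + q * sin \<theta> = p * (q / r) + q * (- p / r)" by simp
    then show thesis using that[of \<theta>] by simp
  qed (use that in auto)
  show thesis
    using that[of "cos (\<theta> / 2)" "sin (\<theta> / 2)"] \<theta> cos_double[of "\<theta> / 2"] sin_double[of "\<theta> / 2"] by simp
qed

text \<open>Equal diagonal entries of \<open>A\<close> correspond to a lower block of
  \<open>M\<close> whose symmetric part is diagonal.\<close>

lemma semidirect_eq_cross:
  "semidirect t a b x y = m33 0 0 0 0 (- a) t 0 (- t) b *v (x \<times> y)"
  by (simp add: vec3_eq_iff mat3_vec_nth cross3_def vector_3 algebra_simps)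

text \<open>Three changes of basis: \<open>g1\<close> makes the inner product standard,
  \<open>R\<close> rotates \<open>e\<^sub>1\<close> to the common kernel vector \<open>u\<close>,
  and \<open>K\<close> rotates the orthogonal plane until the symmetric part of the block is
  diagonal. The rotations keep the inner product standard.\<close>

lemma lie_algebra_normal_form:
  assumes "lie_algebra br" "solvable_lie br" "P \<in> PosDef"
  obtains g t a b where "invertible g" "pull g P = mat 1" "transport g br = semidirect t a b"
proof -
  obtain L where L: "invertible L" "P = pull L (mat 1)" using PosDef_eq_pull_mat_1[OF assms(3)] .
  define g1 where "g1 = matrix_inv L"
  have g1: "invertible g1" "pull g1 P = mat 1"
    using L by (simp_all add: g1_def matrix_inv_matrix_inv pull_inverse)
  let ?br1 = "transport g1 br"
  have lie1: "lie_algebra ?br1" by (rule lie_algebra_transport[OF assms(1) g1(1)])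
  obtain n where n: "n \<noteq> 0" "\<And>x y. n \<bullet> br x y = 0" using solvable_derived_orthogonal[OF assms(2)] by blast
  \<comment> \<open>\<open>n\<close> annihilates all brackets, so it moves to the new basis as a
    covector.\<close>
  have n1: "n v* g1 \<noteq> 0"
    using n(1) invertible_eq_0_iff[OF matrix_inv_transpose(2)[OF g1(1)], of n] by simp
  have n2: "(n v* g1) \<bullet> ?br1 x y = 0" for x y
    by (simp add: dot_lmul_matrix transport_def matrix_inv_cancel g1 n)
  obtain M where M: "\<And>x y. ?br1 x y = M *v (x \<times> y)" using bracket_eq_cross[OF lie1] by blast
  obtain u where u: "norm u = 1" "M *v u = 0" "u v* M = 0"
    using bracket_common_kernel[OF lie1 M n1 n2] by blast
  obtain f where f: "orthogonal_transformation f" "det (matrix f) = 1" "f (axis 1 1) = u"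
    using rotation_exists_1[of "axis 1 1 :: vec3" u] u(1) by (auto simp: norm_axis_1)
  define R where "R = matrix f"
  have R: "rotation_matrix R"
    using f by (simp add: R_def rotation_matrix_def orthogonal_transformation_matrix)
  have Ru: "R *v axis 1 1 = u"
    using f orthogonal_transformation_linear[OF f(1)] matrix_vector_mul(2)[of f] by (metis R_def)
  note R1 = transport_rotation[OF M R]
  define N where "N = pull R M"
  have "N *v axis 1 1 = 0"
    by (simp add: N_def pull_def matrix_vector_mul_assoc[symmetric] Ru u del: transpose_matrix_vector)
  then have N1: "N $ 1 $ 1 = 0" "N $ 2 $ 1 = 0" "N $ 3 $ 1 = 0"
    by (simp_all add: vec3_eq_iff mat3_vec_nth axis_def)
  have "axis 1 1 v* N = (R *v axis 1 1) v* M v* R"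
    by (simp add: N_def pull_def vector_matrix_mul_assoc[symmetric])
  then have "axis 1 1 v* N = 0" by (simp add: Ru u)
  then have N2: "N $ 1 $ 2 = 0" "N $ 1 $ 3 = 0"
    by (simp_all add: vec3_eq_iff vector_matrix_mult_def sum_3 axis_def)
  obtain c s where cs: "c\<^sup>2 + s\<^sup>2 = 1"
    "(N $ 2 $ 3 + N $ 3 $ 2) * (c\<^sup>2 - s\<^sup>2) + (N $ 3 $ 3 - N $ 2 $ 2) * (2 * s * c) = 0"
    using rotate_off_diagonal by blast
  define K where "K = m33 1 0 0 0 c (- s) 0 s c"
  have K: "rotation_matrix K"
    using cs(1) by (simp add: rotation_matrix_def orthogonal_matrix K_def det_3 mat3_eq_iff mat3_simps power2_eq_square add.commute)
  have M2: "transport R ?br1 x y = N *v (x \<times> y)" for x y using R1(3) by (simp add: N_def)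
  note K1 = transport_rotation[OF M2 K]
  define t a b where "t = pull K N $ 2 $ 3" "a = - pull K N $ 2 $ 2" "b = pull K N $ 3 $ 3"
  note tab = this
  \<comment> \<open>This sum is the expression annihilated by the choice of \<open>c\<close> and
    \<open>s\<close>.\<close>
  have "pull K N $ 3 $ 2 + pull K N $ 2 $ 3 = 0"
    using cs(2) by (simp add: pull_def K_def mat3_simps N1 N2 power2_eq_square algebra_simps)
  moreover have "pull K N $ 1 $ i = 0" "pull K N $ i $ 1 = 0" for i
    by (simp_all add: pull_def K_def mat3_simps N1 N2)
  ultimately have "pull K N = m33 0 0 0 0 (- a) t 0 (- t) b"
    by (simp add: mat3_eq_iff tab)
  then have "transport K (transport R ?br1) = semidirect t a b"
    using K1(3) by (intro ext) (simp add: semidirect_eq_cross)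
  then have "transport (g1 ** R ** K) br = semidirect t a b"
    by (simp add: transport_transport g1(1) R1(1) K1(1) invertible_mult)
  moreover have "pull (g1 ** R ** K) P = mat 1"
    by (simp add: pull_mult[symmetric] g1(2) R1(2) K1(2))
  ultimately show thesis
    using that[of "g1 ** R ** K"] g1(1) R1(1) K1(1) by (simp add: invertible_mult)
qed

theorem mainTheorem1:
  fixes br :: "real^3 \<Rightarrow> real^3 \<Rightarrow> real^3" and P :: "real^3^3"
  assumes "lie_algebra br" and "solvable_lie br" and "P \<in> PosDef"
  shows "solvsoliton br P \<longleftrightarrow> minimal_submanifold (metric_class br P)"
proof -
  obtain g t a b where g: "invertible g" "pull g P = mat 1" "transport g br = semidirect t a b"
    using lie_algebra_normal_form[OF assms] .
  have bl: "bilinear br" using assms(1) by (simp add: lie_algebra_def)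
  show ?thesis
    using solvsoliton_transport[OF assms(3) bl g(1)] minimal_transport[OF g(1) assms(3), of br]
    unfolding g(2,3) solvsoliton_semidirect_iff minimal_semidirect_iff by blast
qed

end
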